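(* Let $\boldsymbol\omega\in\boldsymbol\Omega_\alpha$, $y_0\in E$, $a\in\mathcal C^2_{\boldsymbol\omega,\boldsymbol\alpha}(E^{d\times|E|})$, $b\in\mathcal C^1_{\omega,\boldsymbol\alpha}(E^d)$, $\lambda\in\Omega_\beta(E^{d\times d\times|E|})$ and $l\in\Omega_\beta(E^{d\times d})$. Then the linear rough differential equation $$\theta_t=y_0+\int_0^t\big[a_s\otimes\theta_s+b_s\big]\cdot d\boldsymbol\omega_s+\int_0^t\big[\lambda_s\otimes\theta_s+l_s\big]:d\langle\boldsymbol\omega\rangle_s,\qquad t\in[0,T],$$ where $(a\otimes y)_p:=\sum_{k=1}^{|E|}a_{p,k}\,y_k\in E$ and $(\lambda\otimes y)_{p,q}:=\sum_{k=1}^{|E|}\lambda_{p,q,k}\,y_k\in E$ for $y=(y_1,\dots,y_{|E|})\in E$, has a unique solution.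
   Context: Fix $T>0$, $\mathbb T=[0,T]$, $\mathbb T^2=\{(s,t):0\le s<t\le T\}$, $d\ge1$; $E=\mathbb R^{|E|}$ is a Euclidean space; $\varphi_{s,t}:=\varphi_t-\varphi_s$ for a path $\varphi$. Fix $\boldsymbol\alpha=(\alpha,\beta)$ with $\alpha\in(\frac13,\frac12)$, $\beta\in(1-2\alpha,\alpha]$. For $\gamma>0$, $\Omega_\gamma(E)$ is the set of continuous $\omega:\mathbb T\to E$ with $\sup_{\mathbb T^2}|\omega_{s,t}|/|t-s|^\gamma<\infty$; $\underline\Omega_\gamma(E)$ is the set of continuous $\underline\omega:\mathbb T^2\to E$ with $\sup_{\mathbb T^2}|\underline\omega_{s,t}|/|t-s|^\gamma<\infty$. Rough paths: $\boldsymbol\Omega^0_\alpha$ is the set of $\boldsymbol\omega=(\omega,\underline\omega)\in\Omega_\alpha(\mathbb R^d)\times\underline\Omega_{2\alpha}(\mathbb R^{d\times d})$ with $\underline\omega_{s,t}-\underline\omega_{s,r}-\underline\omega_{r,t}=\omega_{s,r}\omega_{r,t}^*$ for $s<r<t$. $\boldsymbol\Omega_\alpha$ is the set of $\boldsymbol\omega\in\boldsymbol\Omega^0_\alpha$ for which there is a dense $A\subset[0,T)$ with $\limsup_{t\downarrow s}|v\cdot\omega_{s,t}|/(t-s)^{2\alpha}=\infty$ for all $s\in A$, $v\ne0$. Bracket: $\langle\boldsymbol\omega\rangle_t:=\omega_{0,t}\omega_{0,t}^*-\underline\omega_{0,t}-\underline\omega_{0,t}^*\in\mathbb S^d$. Controlled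 paths: $\mathcal C^1_{\omega,\boldsymbol\alpha}(E)$ is the set of $\theta\in\Omega_\beta(E)$ for which there is $\partial_\omega\theta=(\partial_{\omega^1}\theta,\dots,\partial_{\omega^d}\theta)\in\Omega_\beta(E^{1\times d})$ with $R^{\omega,\theta}_{s,t}:=\theta_{s,t}-\partial_\omega\theta_s\,\omega_{s,t}$ in $\underline\Omega_{\alpha+\beta}(E)$. Elements are understood together with $\partial_\omega\theta$ (part of the data whenever not unique). Integrals: for $\theta=(\theta_1,\dots,\theta_d)^*\in\mathcal C^1_{\omega,\boldsymbol\alpha}(E^d)$, $\int_0^t\theta_s\cdot d\boldsymbol\omega_s$ is the limit over partitions of $[0,t]$ with mesh tending to $0$ of $\sum_k\big[\sum_i\theta_{i,t_k}\omega^i_{t_k,t_{k+1}}+\sum_{i,j}\partial_{\omega^j}\theta_{i,t_k}\,\underline\omega^{ji}_{t_k,t_{k+1}}\big]$. For $c\in\Omega_\beta(E^{d\times d})$, $\int c:d\langle\boldsymbol\omega\rangle=\sum_{p,q}\int c_{pq}\,d\langle\boldsymbol\omega\rangle^{pq}$ is the Young integral. $\mathcal C^2_{\boldsymbol\omega,\boldsymbol\alpha}(E)$: the set of $\theta\in\mathcal C^1_{\omega,\boldsymbol\alpha}(E)$ with $\partial_\omega\theta\in\mathcal C^1_{\omega,\boldsymbol\alpha}(E^{1\times d})$ for which there is a symmetric $D^{\boldsymbol\omega}_t\theta\in\Omega_\beta(E^{d\times d})$ with $d\theta_t=\partial_\omega\theta_t\,d\boldsymbol\omega_t+[D^{\boldsymbol\omega}_t\theta_t+\frac12\partial_\omega[(\partial_\omega\theta_t)^*]]:d\langle\boldsymbol\omega\rangle_t$.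 Solution: $\theta\in\mathcal C^1_{\omega,\boldsymbol\alpha}(E)$ with $\partial_\omega\theta_t=(a_t\otimes\theta_t+b_t)^*$ satisfying the equation, where the rough integrand carries the derivative given by the product rule, $\partial_\omega(a\otimes\theta+b)_p=\sum_k[\theta_k\,\partial_\omega a_{p,k}+a_{p,k}\,\partial_\omega\theta_k]+\partial_\omega b_p$. Solutions are automatically in $\mathcal C^2_{\boldsymbol\omega,\boldsymbol\alpha}(E)$. *)

theory Defs
  imports "HOL-Analysis.Analysis"
begin

text \<open>
  Paths on the horizon from 0 to \<open>T\<close> are functions on all of \<^typ>\<open>real\<close>; two-parameter maps are curried
  functions \<open>F s t\<close>.  Only values at times of \<open>{0..T}\<close>, resp. at pairs \<open>0 \<le> s < t \<le> T\<close>, are ever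
  used.  The space \<open>E\<close> of dimension \<open>CARD('e)\<close> is \<open>real^'e\<close>; notions that make sense for every
  target space are stated for \<open>'v\<close>.  An element of the product of \<open>d\<close> copies of \<open>'v\<close> is of type
  \<open>'v^'d\<close>, whether it is thought of as a row or as a column.
\<close>

definition time_pairs :: "real \<Rightarrow> (real \<times> real) set" where
  "time_pairs T = {(s, t). 0 \<le> s \<and> s < t \<and> t \<le> T}"

definition holder_path :: "real \<Rightarrow> real \<Rightarrow> (real \<Rightarrow> 'v::real_normed_vector) \<Rightarrow> bool" where
  "holder_path T \<gamma> f \<longleftrightarrow>
     continuous_on {0..T} f \<and>
     bdd_above ((\<lambda>(s, t). norm (f t - f s) / (t - s) powr \<gamma>) ` time_pairs T)"

definition holder_pairs :: "real \<Rightarrow> real \<Rightarrow> (real \<Rightarrow> real \<Rightarrow> 'v::real_normed_vector) \<Rightarrow> bool" where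
  "holder_pairs T \<gamma> F \<longleftrightarrow>
     continuous_on (time_pairs T) (\<lambda>(s, t). F s t) \<and>
     bdd_above ((\<lambda>(s, t). norm (F s t) / (t - s) powr \<gamma>) ` time_pairs T)"

definition outer :: "real^'d \<Rightarrow> real^'d \<Rightarrow> real^'d^'d" where
  "outer x y = (\<chi> i j. x $ i * y $ j)"

definition rough_path0 ::
    "real \<Rightarrow> real \<Rightarrow> (real \<Rightarrow> real^'d) \<Rightarrow> (real \<Rightarrow> real \<Rightarrow> real^'d^'d) \<Rightarrow> bool" where
  "rough_path0 T \<alpha> \<omega> W \<longleftrightarrow>
     holder_path T \<alpha> \<omega> \<and> holder_pairs T (2 * \<alpha>) W \<and>
     (\<forall>s r t. 0 \<le> s \<and> s < r \<and> r < t \<and> t \<le> T \<longrightarrow>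
        W s t - W s r - W r t = outer (\<omega> r - \<omega> s) (\<omega> t - \<omega> r))"

definition rough_path ::
    "real \<Rightarrow> real \<Rightarrow> (real \<Rightarrow> real^'d) \<Rightarrow> (real \<Rightarrow> real \<Rightarrow> real^'d^'d) \<Rightarrow> bool" where
  "rough_path T \<alpha> \<omega> W \<longleftrightarrow>
     rough_path0 T \<alpha> \<omega> W \<and>
     (\<exists>A. A \<subseteq> {0..<T} \<and> {0..<T} \<subseteq> closure A \<and>
        (\<forall>s\<in>A. \<forall>v. v \<noteq> 0 \<longrightarrow>
           Limsup (at_right s)
             (\<lambda>t. ereal (\<bar>v \<bullet> (\<omega> t - \<omega> s)\<bar> / (t - s) powr (2 * \<alpha>))) = \<infinity>))"

text \<open>The second level \<open>W s t\<close> is only meaningful for \<open>s < t\<close>, so the bracket at time 0 is set to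
  its limit, which is 0 by the Hoelder bound on \<open>W\<close>.\<close>

definition bracket ::
    "(real \<Rightarrow> real^'d) \<Rightarrow> (real \<Rightarrow> real \<Rightarrow> real^'d^'d) \<Rightarrow> real \<Rightarrow> real^'d^'d" where
  "bracket \<omega> W t =
     (if t = 0 then 0
      else outer (\<omega> t - \<omega> 0) (\<omega> t - \<omega> 0) - W 0 t - transpose (W 0 t))"

text \<open>\<open>\<theta>' t $ i\<close> is the derivative of \<open>\<theta>\<close> in the direction of the \<open>i\<close>-th component of \<open>\<omega>\<close>; the
  predicate concerns the pair, since the derivative is part of the data.\<close>

definition controlled1 ::
    "real \<Rightarrow> real \<Rightarrow> real \<Rightarrow> (real \<Rightarrow> real^'d) \<Rightarrow>
     (real \<Rightarrow> 'v::real_normed_vector) \<Rightarrow> (real \<Rightarrow> 'v^'d) \<Rightarrow> bool" where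
  "controlled1 T \<alpha> \<beta> \<omega> \<theta> \<theta>' \<longleftrightarrow>
     holder_path T \<beta> \<theta> \<and> holder_path T \<beta> \<theta>' \<and>
     holder_pairs T (\<alpha> + \<beta>)
       (\<lambda>s t. \<theta> t - \<theta> s - (\<Sum>i\<in>UNIV. (\<omega> t - \<omega> s) $ i *\<^sub>R \<theta>' s $ i))"

text \<open>\<open>I\<close> is the limit of the sums of \<open>\<Xi> u v\<close> over the consecutive points \<open>u < v\<close> of the partitions
  \<open>0 = p 0 < \<dots> < p n = t\<close>, as the mesh tends to 0.\<close>

definition has_partition_limit ::
    "(real \<Rightarrow> real \<Rightarrow> 'v::real_normed_vector) \<Rightarrow> real \<Rightarrow> 'v \<Rightarrow> bool" where
  "has_partition_limit \<Xi> t I \<longleftrightarrow>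
     (\<forall>\<epsilon>>0. \<exists>\<delta>>0. \<forall>(n::nat) (p::nat \<Rightarrow> real).
        p 0 = 0 \<and> p n = t \<and> (\<forall>k<n. p k < p (Suc k) \<and> p (Suc k) - p k < \<delta>) \<longrightarrow>
        norm ((\<Sum>k<n. \<Xi> (p k) (p (Suc k))) - I) < \<epsilon>)"

text \<open>In the next definition \<open>\<theta>' u $ j $ i\<close> is the derivative of the \<open>i\<close>-th component of the integrand
  in direction \<open>j\<close>.\<close>

definition has_rough_integral ::
    "(real \<Rightarrow> real^'d) \<Rightarrow> (real \<Rightarrow> real \<Rightarrow> real^'d^'d) \<Rightarrow>
     (real \<Rightarrow> ('v::real_normed_vector)^'d) \<Rightarrow> (real \<Rightarrow> 'v^'d^'d) \<Rightarrow> real \<Rightarrow> 'v \<Rightarrow> bool" where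
  "has_rough_integral \<omega> W \<theta> \<theta>' t I \<longleftrightarrow>
     has_partition_limit
       (\<lambda>u v. (\<Sum>i\<in>UNIV. (\<omega> v - \<omega> u) $ i *\<^sub>R \<theta> u $ i) +
              (\<Sum>i\<in>UNIV. \<Sum>j\<in>UNIV. W u v $ j $ i *\<^sub>R \<theta>' u $ j $ i)) t I"

definition has_young_integral ::
    "(real \<Rightarrow> 'v::real_normed_vector) \<Rightarrow> (real \<Rightarrow> real) \<Rightarrow> real \<Rightarrow> 'v \<Rightarrow> bool" where
  "has_young_integral c g t J \<longleftrightarrow>
     has_partition_limit (\<lambda>u v. (g v - g u) *\<^sub>R c u) t J"

definition has_bracket_integral ::
    "(real \<Rightarrow> real^'d) \<Rightarrow> (real \<Rightarrow> real \<Rightarrow> real^'d^'d) \<Rightarrow>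
     (real \<Rightarrow> ('v::real_normed_vector)^'d^'d) \<Rightarrow> real \<Rightarrow> 'v \<Rightarrow> bool" where
  "has_bracket_integral \<omega> W c t J \<longleftrightarrow>
     (\<exists>Y. (\<forall>p q. has_young_integral (\<lambda>s. c s $ p $ q) (\<lambda>s. bracket \<omega> W s $ p $ q) t (Y p q)) \<and>
          J = (\<Sum>p\<in>UNIV. \<Sum>q\<in>UNIV. Y p q))"

text \<open>As for \<^const>\<open>controlled1\<close>, the first derivative is part of the data; \<open>\<theta>'' t $ q $ p\<close> is the
  derivative in direction \<open>q\<close> of \<open>\<theta>' t $ p\<close>, i.e. the entry \<open>(p, q)\<close> of the matrix
  \<open>\<partial>\<^sub>\<omega>[(\<partial>\<^sub>\<omega>\<theta>)\<^sup>*]\<close>.\<close>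

definition controlled2 ::
    "real \<Rightarrow> real \<Rightarrow> real \<Rightarrow> (real \<Rightarrow> real^'d) \<Rightarrow> (real \<Rightarrow> real \<Rightarrow> real^'d^'d) \<Rightarrow>
     (real \<Rightarrow> 'v::real_normed_vector) \<Rightarrow> (real \<Rightarrow> 'v^'d) \<Rightarrow> bool" where
  "controlled2 T \<alpha> \<beta> \<omega> W \<theta> \<theta>' \<longleftrightarrow>
     controlled1 T \<alpha> \<beta> \<omega> \<theta> \<theta>' \<and>
     (\<exists>\<theta>'' D.
        controlled1 T \<alpha> \<beta> \<omega> \<theta>' \<theta>'' \<and>
        holder_path T \<beta> D \<and> (\<forall>t\<in>{0..T}. transpose (D t) = D t) \<and>
        (\<forall>t\<in>{0..T}. \<exists>I J.
           has_rough_integral \<omega> W \<theta>' \<theta>'' t I \<and>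
           has_bracket_integral \<omega> W
             (\<lambda>s. \<chi> p q. D s $ p $ q + (1/2) *\<^sub>R \<theta>'' s $ q $ p) t J \<and>
           \<theta> t - \<theta> 0 = I + J))"

definition tensor1 :: "(real^'e)^'e^'d \<Rightarrow> real^'e \<Rightarrow> (real^'e)^'d" where
  "tensor1 a y = (\<chi> p. \<Sum>k\<in>UNIV. y $ k *\<^sub>R a $ p $ k)"

definition tensor2 :: "(real^'e)^'e^'d^'d \<Rightarrow> real^'e \<Rightarrow> (real^'e)^'d^'d" where
  "tensor2 l y = (\<chi> p q. \<Sum>k\<in>UNIV. y $ k *\<^sub>R l $ p $ q $ k)"

text \<open>Product rule: direction \<open>j\<close>, component \<open>p\<close> of the derivative of \<open>a \<otimes> \<theta> + b\<close>, given the
  derivatives \<open>a'\<close>, \<open>b'\<close>, \<open>\<theta>'\<close> (all at a fixed time).\<close>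

definition integrand_deriv ::
    "(real^'e)^'e^'d \<Rightarrow> ((real^'e)^'e^'d)^'d \<Rightarrow> ((real^'e)^'d)^'d \<Rightarrow>
     real^'e \<Rightarrow> (real^'e)^'d \<Rightarrow> ((real^'e)^'d)^'d" where
  "integrand_deriv a a' b' \<theta> \<theta>' =
     (\<chi> j p. (\<Sum>k\<in>UNIV. \<theta> $ k *\<^sub>R a' $ j $ p $ k + (\<theta>' $ j $ k) *\<^sub>R a $ p $ k) + b' $ j $ p)"

definition linear_rde_solution ::
    "real \<Rightarrow> real \<Rightarrow> real \<Rightarrow> (real \<Rightarrow> real^'d) \<Rightarrow> (real \<Rightarrow> real \<Rightarrow> real^'d^'d) \<Rightarrow>
     (real \<Rightarrow> (real^'e)^'e^'d) \<Rightarrow> (real \<Rightarrow> ((real^'e)^'e^'d)^'d) \<Rightarrow>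
     (real \<Rightarrow> (real^'e)^'d) \<Rightarrow> (real \<Rightarrow> ((real^'e)^'d)^'d) \<Rightarrow>
     (real \<Rightarrow> (real^'e)^'e^'d^'d) \<Rightarrow> (real \<Rightarrow> (real^'e)^'d^'d) \<Rightarrow> real^'e \<Rightarrow>
     (real \<Rightarrow> real^'e) \<Rightarrow> (real \<Rightarrow> (real^'e)^'d) \<Rightarrow> bool" where
  "linear_rde_solution T \<alpha> \<beta> \<omega> W a a' b b' \<Lambda> l y0 \<theta> \<theta>' \<longleftrightarrow>
     controlled1 T \<alpha> \<beta> \<omega> \<theta> \<theta>' \<and>
     (\<forall>t\<in>{0..T}. \<theta>' t = tensor1 (a t) (\<theta> t) + b t) \<and>
     (\<forall>t\<in>{0..T}. \<exists>I J.
        has_rough_integral \<omega> W (\<lambda>s. tensor1 (a s) (\<theta> s) + b s)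
          (\<lambda>s. integrand_deriv (a s) (a' s) (b' s) (\<theta> s) (\<theta>' s)) t I \<and>
        has_bracket_integral \<omega> W (\<lambda>s. tensor2 (\<Lambda> s) (\<theta> s) + l s) t J \<and>
        \<theta> t = y0 + I + J)"

end

theory Submission
  imports Defs
begin

text \<open>
  Freezing the coefficients at time \<open>s\<close> turns the equation into an affine one-step map \<open>step s t\<close>.
  The product rule and Chen's relation make these maps an almost flow: \<open>step r t \<circ> step s r\<close> and
  \<open>step s t\<close> differ by \<open>O((t - s) powr (2 * \<alpha> + \<beta>))\<close>, an order greater than 1.  An almost flow of
  affine maps has, for each starting point, exactly one path \<open>u\<close> with
  \<open>u t = step s t (u s) + O((t - s) powr (2 * \<alpha> + \<beta>))\<close>: existence by compactness from Euler schemes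
  on finite sets of times, uniqueness because halving the time steps contracts the error.  The
  sewing lemma is the special case of translations; it shows that the solutions of the equation are
  exactly these paths.
\<close>

section \<open>Almost flows of affine maps\<close>

text \<open>The exponent \<open>2 * \<alpha> + \<beta>\<close> has two sources in the defect of
  \<open>step\<close>: an increment of \<omega>, of order \<alpha>, meets a Taylor remainder of the
  integrand, of order \<alpha> + \<beta>; and an increment of W, of order 2\<alpha>, meets an
  increment of the derivative, of order \<beta>. No fixed point argument in a space of controlled
  paths is used, so no controlled norms of products and no patching of local solutions of varying
  length occur. The price is that Euler estimates must hold with the same constants on every finite
  set of times, however coarse or irregular, since compactness of a product of balls replaces
  convergence of the schemes. Affinity enters through the weight \<open>1 + norm x\<close>: a growth
  bound with this weight is also a Lipschitz bound on the linear part, so one estimate of the defect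
  serves existence (growth) and uniqueness (differences). The integrand stays affine in the state
  even after its derivative is inserted, because the derivative of the solution is itself prescribed
  as an affine function of the state.\<close>

definition small_order :: "real \<Rightarrow> real \<Rightarrow> (real \<Rightarrow> real \<Rightarrow> 'v::real_normed_vector) \<Rightarrow> bool" where
  "small_order T \<mu> g \<longleftrightarrow> (\<exists>K h. 0 \<le> K \<and> 0 < h \<and>
     (\<forall>s t. 0 \<le> s \<and> s < t \<and> t \<le> T \<and> t - s \<le> h \<longrightarrow> norm (g s t) \<le> K * (t - s) powr \<mu>))"

text \<open>At a large multiple of z the constant term of the growth bound is negligible: evaluate
  at \<open>real (Suc n) *\<^sub>R z\<close>, divide by \<open>Suc n\<close> and let n tend to
  infinity. The Lipschitz constant is the growth constant itself.\<close>

lemma affine_growth_lipschitz: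
  fixes F :: "'v::real_normed_vector \<Rightarrow> 'w::real_normed_vector"
  assumes "linear (\<lambda>x. F x - F 0)" and growth: "\<And>x. norm (F x) \<le> D * (1 + norm x)"
  shows "norm (F x - F y) \<le> D * norm (x - y)"
proof -
  interpret linear "\<lambda>x. F x - F 0" by fact
  define z where "z = x - y"
  have eq: "F x - F y = F z - F 0"
    using diff[of x y] by (simp add: z_def)
  have D: "0 \<le> D"
    using order_trans[OF norm_ge_zero growth[of 0]] by simp
  have b: "norm (F z - F 0) \<le> D * norm z + (2 * D) * inverse (real (Suc n))" for n
  proof -
    have "real (Suc n) * norm (F z - F 0) = norm (F (real (Suc n) *\<^sub>R z) - F 0)"
      using scale[of "real (Suc n)" z] by simp
    also have "\<dots> \<le> D * (1 + norm (real (Suc n) *\<^sub>R z)) + D * (1 + norm (0::'v))"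
      by (rule order_trans[OF norm_triangle_ineq4 add_mono[OF growth growth]])
    also have "\<dots> = real (Suc n) * (D * norm z) + 2 * D"
      by (simp add: algebra_simps del: of_nat_Suc)
    finally have "norm (F z - F 0) \<le> (real (Suc n) * (D * norm z) + 2 * D) / real (Suc n)"
      by (simp add: field_simps del: of_nat_Suc)
    also have "\<dots> = D * norm z + (2 * D) * inverse (real (Suc n))"
      by (simp add: field_simps del: of_nat_Suc)
    finally show ?thesis .
  qed
  have "(\<lambda>n. D * norm z + (2 * D) * inverse (real (Suc n))) \<longlonglongrightarrow> D * norm z + (2 * D) * 0"
    by (intro tendsto_intros LIMSEQ_inverse_real_of_nat)
  then have "norm (F z - F 0) \<le> D * norm z + (2 * D) * 0"
    using b by (intro LIMSEQ_le_const) auto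
  then show ?thesis
    by (simp add: eq z_def)
qed

lemma norm_diff_triangle3:
  fixes a b c d :: "'v::real_normed_vector"
  shows "norm (a - d) \<le> norm (a - b) + norm (b - c) + norm (c - d)"
  using norm_triangle_ineq[of "a - b" "b - c"] norm_triangle_ineq[of "a - c" "c - d"] by simp

text \<open>One threshold for two powers: the step estimates have to make the deviation of a step
  from the identity and an error of order \<mu> small together. A zero coefficient reduces it to a
  single power.\<close>

lemma ex_small_powr:
  fixes A B :: real
  assumes "0 < \<alpha>" "0 < \<mu>" "0 < e" "0 \<le> A" "0 \<le> B"
  obtains h where "0 < h" "\<And>d. 0 < d \<Longrightarrow> d \<le> h \<Longrightarrow> A * d powr \<alpha> + B * d powr \<mu> \<le> e"
proof -
  have "((\<lambda>d. A * d powr \<alpha> + B * d powr \<mu>) \<longlongrightarrow> A * 0 + B * 0) (at_right 0)"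
    using assms by (intro tendsto_intros tendsto_zero_powrI[where b = "\<alpha>"] tendsto_zero_powrI[where b = "\<mu>"])
      (auto simp: eventually_at_right_less intro: eventually_mono[OF eventually_at_right_less] tendsto_ident_at)
  then have "eventually (\<lambda>d. A * d powr \<alpha> + B * d powr \<mu> < e) (at_right 0)"
    using assms by (intro order_tendstoD(2)) auto
  then obtain b where b: "b > 0" "\<And>d. 0 < d \<Longrightarrow> d < b \<Longrightarrow> A * d powr \<alpha> + B * d powr \<mu> < e"
    by (auto simp: eventually_at_right[of 0 1])
  show thesis
    by (rule that[of "b/2"]) (use b in \<open>auto intro: less_imp_le\<close>)
qed

lemma powr_le_lower_powr:
  fixes d T \<gamma> \<delta> :: real
  assumes "0 < d" "d \<le> T" "\<gamma> \<le> \<delta>"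
  shows "d powr \<delta> \<le> T powr (\<delta> - \<gamma>) * d powr \<gamma>"
proof -
  have "d powr \<delta> = d powr (\<delta> - \<gamma>) * d powr \<gamma>" by (simp add: powr_add[symmetric])
  also have "\<dots> \<le> T powr (\<delta> - \<gamma>) * d powr \<gamma>"
    using assms by (intro mult_right_mono powr_mono2) auto
  finally show ?thesis .
qed

lemma strict_mono_upto:
  fixes p :: "nat \<Rightarrow> real"
  assumes "\<And>k. k < n \<Longrightarrow> p k < p (Suc k)" "k < m" "m \<le> n"
  shows "p k < p m"
  using assms(2,3)
proof (induction m)
  case (Suc m)
  then show ?case using assms(1)[of m] by (cases "k = m") auto
qed simp

text \<open>Closeness to the identity and smallness of the defect are required as growth bounds
  only; affinity converts them into bounds on differences.\<close>

locale almost_flow =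
  fixes T C \<alpha> \<mu> :: real and L :: "real \<Rightarrow> real \<Rightarrow> 'v::euclidean_space \<Rightarrow> 'v"
  assumes T_nonneg: "0 \<le> T" and C_nonneg: "0 \<le> C" and \<alpha>_pos: "0 < \<alpha>" and \<mu>_gt_1: "1 < \<mu>"
    and affine: "\<And>s t. 0 \<le> s \<Longrightarrow> s < t \<Longrightarrow> t \<le> T \<Longrightarrow> linear (\<lambda>x. L s t x - L s t 0)"
    and near_id: "\<And>s t x. 0 \<le> s \<Longrightarrow> s < t \<Longrightarrow> t \<le> T \<Longrightarrow>
          norm (L s t x - x) \<le> C * (t - s) powr \<alpha> * (1 + norm x)"
    and defect: "\<And>s r t x. 0 \<le> s \<Longrightarrow> s < r \<Longrightarrow> r < t \<Longrightarrow> t \<le> T \<Longrightarrow>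
          norm (L r t (L s r x) - L s t x) \<le> C * (t - s) powr \<mu> * (1 + norm x)"
begin

lemma near_id_lipschitz:
  assumes "0 \<le> s" "s < t" "t \<le> T"
  shows "norm ((L s t x - L s t y) - (x - y)) \<le> C * (t - s) powr \<alpha> * norm (x - y)"
proof -
  have "linear (\<lambda>x. (L s t x - x) - (L s t 0 - 0))"
    using linear_compose_sub[OF affine[OF assms] linear_id] by (simp add: algebra_simps)
  from affine_growth_lipschitz[OF this near_id[OF assms], of x y]
  show ?thesis by (simp add: algebra_simps)
qed

lemma lipschitz:
  assumes "0 \<le> s" "s < t" "t \<le> T"
  shows "norm (L s t x - L s t y) \<le> (1 + C * (t - s) powr \<alpha>) * norm (x - y)"
  using near_id_lipschitz[OF assms, of x y] norm_triangle_ineq2[of "L s t x - L s t y" "x - y"]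
  by (simp add: algebra_simps)

text \<open>The defect is affine in the state, as a difference of affine maps, so its growth bound
  passes to differences. This keeps the uniqueness argument homogeneous in the distance of two
  paths.\<close>

lemma defect_lipschitz:
  assumes "0 \<le> s" "s < r" "r < t" "t \<le> T"
  shows "norm ((L r t (L s r x) - L s t x) - (L r t (L s r y) - L s t y))
           \<le> C * (t - s) powr \<mu> * norm (x - y)"
proof -
  interpret rt: linear "\<lambda>x. L r t x - L r t 0" using affine[of r t] assms by simp
  have "linear (\<lambda>x. (L r t (L s r x - L s r 0) - L r t 0) - (L s t x - L s t 0))"
    using linear_compose_sub[OF linear_compose[OF affine[of s r] affine[of r t]] affine[of s t]] assms
    by (simp add: o_def)
  moreover have "L r t (L s r x - L s r 0) - L r t 0 = L r t (L s r x) - L r t (L s r 0)" for x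
    using rt.diff[of "L s r x" "L s r 0"] by simp
  ultimately have "linear (\<lambda>x. (L r t (L s r x) - L s t x) - (L r t (L s r 0) - L s t 0))"
    by (simp add: algebra_simps)
  from affine_growth_lipschitz[OF this defect[OF assms]] show ?thesis .
qed

lemma growth:
  assumes "0 \<le> s" "s < t" "t \<le> T"
  shows "1 + norm (L s t x) \<le> (1 + C * (t - s) powr \<alpha>) * (1 + norm x)"
  using near_id[OF assms, of x] norm_triangle_ineq2[of "L s t x" x] by (simp add: algebra_simps)

text \<open>Splitting an interval of the grid at its midpoint bounds the error at scale \<open>d\<close> by two errors at
  scale \<open>d / 2\<close> and a defect of order \<open>d powr \<mu>\<close>; as \<open>2 * (d / 2) powr \<mu> < d powr \<mu>\<close>, the bound
  reproduces itself.\<close>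

lemma euler_local_error:
  obtains K h where "0 \<le> K" "0 < h"
    "\<And>(p::nat \<Rightarrow> real) u n i j. \<lbrakk>0 \<le> p 0; \<And>k. k < n \<Longrightarrow> p k < p (Suc k); p n \<le> T;
       \<And>k. k < n \<Longrightarrow> u (Suc k) = L (p k) (p (Suc k)) (u k); i < j; j \<le> n; p j - p i \<le> h\<rbrakk> \<Longrightarrow>
       norm (u j - L (p i) (p j) (u i)) \<le> K * (p j - p i) powr \<mu> * (1 + norm (u i)) \<and>
       1 + norm (u j) \<le> 2 * (1 + norm (u i))"
proof -
  \<comment> \<open>q is the total factor of two errors at half scale, below 1 because \<mu> > 1.
    One half of the slack 1 - q absorbs the growth factors 1 + e, the other half the defects; this
    dictates e and K.\<close>
  define q where "q = 2 powr (1 - \<mu>)"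
  have q: "0 < q" "q < 1"
    using powr_less_mono[of "1 - \<mu>" 0 2] \<mu>_gt_1 by (auto simp: q_def)
  define e where "e = (1 - q) / 4"
  have e: "0 < e" "e < 1"
    using q by (auto simp: e_def)
  \<comment> \<open>3 bounds 2 + e, the defects of one splitting counted with their growth factors.
    K is fixed before h, so h may be taken small relative to K.\<close>
  define K where "K = 3 * C / ((1 - q) / 2)"
  have K: "0 \<le> K" and CK: "3 * C = K * ((1 - q) / 2)"
    using q C_nonneg by (auto simp: K_def)
  obtain h where h: "0 < h" and small: "\<And>d. 0 < d \<Longrightarrow> d \<le> h \<Longrightarrow> C * d powr \<alpha> + K * d powr \<mu> \<le> e"
    using ex_small_powr[of \<alpha> \<mu> e C K] \<alpha>_pos \<mu>_gt_1 e C_nonneg K by auto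
  show thesis
  proof (rule that[OF K h])
    fix p :: "nat \<Rightarrow> real" and u n i j
    assume p0: "0 \<le> p 0" and pS: "\<And>k. k < n \<Longrightarrow> p k < p (Suc k)" and pn: "p n \<le> T"
      and uS: "\<And>k. k < n \<Longrightarrow> u (Suc k) = L (p k) (p (Suc k)) (u k)"
      and "i < j" "j \<le> n" "p j - p i \<le> h"
    have p_less: "p k < p m" if "k < m" "m \<le> n" for k m
      using strict_mono_upto[of n p k m] pS that by blast
    have p_mono: "p k \<le> p m" if "k \<le> m" "m \<le> n" for k m
      using p_less[of k m] that by (cases "k = m") auto
    have p_ge: "0 \<le> p k" if "k \<le> n" for k
      using p_less[of 0 k] p0 that by (cases "k = 0") auto
    have p_le: "p k \<le> T" if "k \<le> n" for k
      using p_less[of k n] pn that by (cases "k = n") auto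
    \<comment> \<open>An error bound for a pair already controls the growth of the scheme there.
      Stated as an implication, it is available inside the induction for pairs that the induction
      hypothesis covers.\<close>
    have near: "1 + norm (u j) \<le> (1 + e) * (1 + norm (u i))"
      if "i < j" "j \<le> n" "p j - p i \<le> h"
        "norm (u j - L (p i) (p j) (u i)) \<le> K * (p j - p i) powr \<mu> * (1 + norm (u i))" for i j
    proof -
      let ?d = "p j - p i"
      have "norm (u j) \<le> norm (u j - L (p i) (p j) (u i)) + norm (L (p i) (p j) (u i))"
        using norm_triangle_sub[of "u j" "L (p i) (p j) (u i)"] by simp
      also have "1 + \<dots> \<le> K * ?d powr \<mu> * (1 + norm (u i)) + (1 + C * ?d powr \<alpha>) * (1 + norm (u i))"
        using growth[of "p i" "p j" "u i"] p_less[of i j] p_ge[of i] p_le[of j] that by auto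
      also have "\<dots> = (1 + (C * ?d powr \<alpha> + K * ?d powr \<mu>)) * (1 + norm (u i))"
        by (simp add: algebra_simps)
      also have "\<dots> \<le> (1 + e) * (1 + norm (u i))"
        using small[of ?d] p_less[of i j] that by (intro mult_right_mono) auto
      finally show ?thesis by simp
    qed
    have main: "norm (u j - L (p i) (p j) (u i)) \<le> K * (p j - p i) powr \<mu> * (1 + norm (u i))"
      if "i < j" "j \<le> n" "p j - p i \<le> h" for i j
      using that
    proof (induction "j - i" arbitrary: i j rule: less_induct)
      case less
      define d where "d = p j - p i"
      have d: "0 < d" "d \<le> h"
        using p_less[of i j] less.prems by (auto simp: d_def)
      define D where "D = d powr \<mu>"
      have D: "0 \<le> D" by (simp add: D_def)
      have half: "(d / 2) powr \<mu> = q / 2 * D"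
        using d by (simp add: D_def q_def powr_divide powr_diff field_simps)
      have half_mono: "x powr \<mu> \<le> q / 2 * D" if "0 \<le> x" "x \<le> d / 2" for x
        unfolding half[symmetric] using that \<mu>_gt_1 by (intro powr_mono2) auto
      have mono: "x powr \<mu> \<le> D" "C * x powr \<alpha> \<le> e" if "0 < x" "x \<le> d" for x
      proof -
        show "x powr \<mu> \<le> D" unfolding D_def using that \<mu>_gt_1 by (intro powr_mono2) auto
        show "C * x powr \<alpha> \<le> e" using small[of x] that d K
          by (smt (verit) powr_ge_zero mult_nonneg_nonneg)
      qed
      \<comment> \<open>The midpoint need not be a grid point. m is the last index in the first half
        and m + 1 lies beyond it; the scheme is exact from m to m + 1, so this middle piece brings
        no error of its own, only a second defect.\<close>
      obtain m where m: "i \<le> m" "m < j" "p m - p i \<le> d / 2" "p j - p (Suc m) \<le> d / 2"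
      proof -
        let ?P = "\<lambda>k. p (i + k) - p i > d / 2"
        have "?P (j - i)" "\<not> ?P 0" using less.prems d by (auto simp: d_def)
        from ex_least_nat_less[of ?P, OF this] obtain k
          where "k < j - i" "\<forall>i\<le>k. \<not> ?P i" "?P (Suc k)" by auto
        then show thesis by (intro that[of "i + k"]) (auto simp: d_def field_simps)
      qed
      have pm: "0 \<le> p m" "p m < p (Suc m)" "p (Suc m) \<le> p j" "p i \<le> p m" "p j \<le> T" "0 \<le> p i"
        using m less.prems p_ge[of m] p_ge[of i] p_le[of j] p_less[of m "Suc m"] p_mono[of "Suc m" j] p_mono[of i m]
        by simp_all
      \<comment> \<open>From m to j only the error from m + 1 on and one defect enter; if m + 1 = j,
        the left side is 0.\<close>
      have right: "norm (u j - L (p m) (p j) (u m)) \<le> (K * (q / 2 * D) * (1 + e) + C * D) * (1 + norm (u m))"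
      proof (cases "Suc m = j")
        case True
        then show ?thesis using uS[of m] m less.prems K C_nonneg D e q by auto
      next
        case False
        then have sm: "Suc m < j" using m by simp
        let ?n = "Suc m"
        have IH: "norm (u j - L (p ?n) (p j) (u ?n)) \<le> K * (p j - p ?n) powr \<mu> * (1 + norm (u ?n))"
          by (rule less.hyps) (use m sm less.prems p_less[of i ?n] in auto)
        have un: "1 + norm (u ?n) \<le> (1 + e) * (1 + norm (u m))"
        proof -
          have "1 + norm (u ?n) \<le> (1 + C * (p ?n - p m) powr \<alpha>) * (1 + norm (u m))"
            using uS[of m] growth[of "p m" "p ?n" "u m"] pm sm less.prems by simp
          also have "\<dots> \<le> (1 + e) * (1 + norm (u m))"
            using mono(2)[of "p ?n - p m"] pm by (intro mult_right_mono) (auto simp: d_def)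
          finally show ?thesis .
        qed
        have "norm (u j - L (p ?n) (p j) (u ?n)) \<le> K * (q / 2 * D) * ((1 + e) * (1 + norm (u m)))"
          using IH half_mono[of "p j - p ?n"] m pm un K q D
          by (smt (verit) mult_mono mult_nonneg_nonneg norm_ge_zero powr_ge_zero divide_nonneg_nonneg)
        moreover have "norm (L (p ?n) (p j) (u ?n) - L (p m) (p j) (u m)) \<le> C * D * (1 + norm (u m))"
        proof -
          have "norm (L (p ?n) (p j) (u ?n) - L (p m) (p j) (u m))
              \<le> C * (p j - p m) powr \<mu> * (1 + norm (u m))"
            using defect[of "p m" "p ?n" "p j" "u m"] uS[of m] pm sm less.prems p_less[of ?n j] by simp
          also have "\<dots> \<le> C * D * (1 + norm (u m))"
            using mono(1)[of "p j - p m"] pm C_nonneg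
            by (intro mult_right_mono mult_left_mono) (auto simp: d_def)
          finally show ?thesis .
        qed
        ultimately show ?thesis
          using norm_triangle_ineq[of "u j - L (p ?n) (p j) (u ?n)" "L (p ?n) (p j) (u ?n) - L (p m) (p j) (u m)"]
          by (simp add: distrib_right mult.assoc)
      qed
      \<comment> \<open>The right piece carries two growth factors and the left piece one, which
        raises q to at most (1 + q) / 2. What is left of K * D is the room reserved for the
        defects.\<close>
      have key: "(K * (q / 2 * D) * (1 + e) + C * D) * (1 + e) + K * (q / 2 * D) * (1 + e) + C * D \<le> K * D"
      proof -
        have "(1 + e) * (1 + e) + (1 + e) \<le> 2 * (1 + 2 * e)"
          using e by (simp add: algebra_simps)
        then have "q / 2 * ((1 + e) * (1 + e) + (1 + e)) \<le> q / 2 * (2 * (1 + 2 * e))"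
          using q by (intro mult_left_mono) auto
        also have "\<dots> = q + q * (1 - q) / 2" by (simp add: e_def field_simps)
        also have "\<dots> \<le> q + 1 * (1 - q) / 2" using q by (intro add_left_mono divide_right_mono mult_right_mono) auto
        finally have 1: "q / 2 * ((1 + e) * (1 + e) + (1 + e)) \<le> (1 + q) / 2" by (simp add: field_simps)
        have 2: "C * (2 + e) \<le> K * ((1 - q) / 2)" unfolding CK[symmetric]
          using e C_nonneg mult_left_mono[of "2+e" 3 C] by (simp add: mult.commute)
        have "(K * (q / 2 * D) * (1 + e) + C * D) * (1 + e) + K * (q / 2 * D) * (1 + e) + C * D
          = D * (K * (q / 2 * ((1 + e) * (1 + e) + (1 + e))) + C * (2 + e))"
          by (simp add: field_simps)
        also have "\<dots> \<le> D * (K * ((1 + q) / 2) + K * ((1 - q) / 2))"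
          using D K by (intro mult_left_mono add_mono 1 2)
        also have "\<dots> = K * D" by (simp add: field_simps)
        finally show ?thesis .
      qed
      have pos: "0 \<le> K * (q / 2 * D) * (1 + e) + C * D" using K q D e C_nonneg by simp
      show ?case
      proof (cases "m = i")
        case True
        have "norm (u j - L (p i) (p j) (u i)) \<le> (K * (q / 2 * D) * (1 + e) + C * D) * (1 + norm (u i))"
          using right True by simp
        also have "\<dots> \<le> K * D * (1 + norm (u i))"
        proof (rule mult_right_mono)
          have "K * (q / 2 * D) * (1 + e) + C * D \<le> (K * (q / 2 * D) * (1 + e) + C * D) * (1 + e)"
            using pos e by (simp add: mult_le_cancel_left1)
          moreover have "0 \<le> K * (q / 2 * D) * (1 + e) + C * D" by (rule pos)
          ultimately show "K * (q / 2 * D) * (1 + e) + C * D \<le> K * D" using key by linarith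
        qed simp
        finally show ?thesis by (simp add: D_def d_def)
      next
        case False
        then have im: "i < m" using m by simp
        then have pim: "p i < p m" "p m < p j" using p_less m less.prems by auto
        have IH: "norm (u m - L (p i) (p m) (u i)) \<le> K * (p m - p i) powr \<mu> * (1 + norm (u i))"
          by (rule less.hyps) (use m im less.prems pim in auto)
        have um: "1 + norm (u m) \<le> (1 + e) * (1 + norm (u i))"
          by (rule near[OF im _ _ IH]) (use m less.prems pim in auto)
        have IH': "norm (u m - L (p i) (p m) (u i)) \<le> K * (q / 2 * D) * (1 + norm (u i))"
          using IH half_mono[of "p m - p i"] m pim K
          by (smt (verit) mult_left_mono mult_right_mono norm_ge_zero)
        have "norm (L (p m) (p j) (u m) - L (p m) (p j) (L (p i) (p m) (u i)))
            \<le> (1 + C * (p j - p m) powr \<alpha>) * norm (u m - L (p i) (p m) (u i))"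
          using pm pim by (intro lipschitz) auto
        also have "\<dots> \<le> (1 + e) * (K * (q / 2 * D) * (1 + norm (u i)))"
          using mono(2)[of "p j - p m"] pim e IH' by (intro mult_mono) (auto simp: d_def)
        finally have B: "norm (L (p m) (p j) (u m) - L (p m) (p j) (L (p i) (p m) (u i)))
            \<le> K * (q / 2 * D) * (1 + e) * (1 + norm (u i))" by (simp add: mult_ac)
        have E: "norm (L (p m) (p j) (L (p i) (p m) (u i)) - L (p i) (p j) (u i)) \<le> C * D * (1 + norm (u i))"
          using defect[of "p i" "p m" "p j" "u i"] pm pim by (simp add: D_def d_def)
        have A: "norm (u j - L (p m) (p j) (u m))
            \<le> (K * (q / 2 * D) * (1 + e) + C * D) * (1 + e) * (1 + norm (u i))"
          using right mult_left_mono[OF um pos] by (simp add: mult.assoc)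
        have "norm (u j - L (p i) (p j) (u i)) \<le>
          norm (u j - L (p m) (p j) (u m)) + norm (L (p m) (p j) (u m) - L (p m) (p j) (L (p i) (p m) (u i)))
          + norm (L (p m) (p j) (L (p i) (p m) (u i)) - L (p i) (p j) (u i))"
          by (rule norm_diff_triangle3)
        also have "\<dots> \<le> ((K * (q / 2 * D) * (1 + e) + C * D) * (1 + e) + K * (q / 2 * D) * (1 + e) + C * D)
            * (1 + norm (u i))"
          using A B E by (simp add: distrib_right)
        also have "\<dots> \<le> K * D * (1 + norm (u i))"
          by (rule mult_right_mono[OF key]) simp
        finally show ?thesis by (simp add: D_def d_def)
      qed
    qed
    from main[OF \<open>i < j\<close> \<open>j \<le> n\<close> \<open>p j - p i \<le> h\<close>]
    show "norm (u j - L (p i) (p j) (u i)) \<le> K * (p j - p i) powr \<mu> * (1 + norm (u i)) \<and>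
       1 + norm (u j) \<le> 2 * (1 + norm (u i))"
      using near[OF \<open>i < j\<close> \<open>j \<le> n\<close> \<open>p j - p i \<le> h\<close>] e
        mult_right_mono[of "1 + e" 2 "1 + norm (u i)"] by auto
  qed
qed

end

section \<open>Euler schemes on finite sets of times, with uniform bounds\<close>

lemma strict_enumeration:
  fixes F :: "real set"
  assumes "finite F" "0 \<in> F" "F \<subseteq> {0..T}"
  obtains p :: "nat \<Rightarrow> real" and n where "p 0 = 0" "\<And>k. k < n \<Longrightarrow> p k < p (Suc k)" "p n \<le> T" "F = p ` {..n}"
proof -
  define xs where "xs = sorted_list_of_set F"
  have set: "set xs = F" and sorted: "sorted_wrt (<) xs"
    using assms by (simp_all add: xs_def)
  have len: "0 < length xs" using set assms by (cases xs) auto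
  define n where "n = length xs - 1"
  have F: "F = (!) xs ` {..n}"
    using len by (force simp: set[symmetric] n_def set_conv_nth image_iff Bex_def less_Suc_eq_le[symmetric])
  have mono: "xs ! k < xs ! m" if "k < m" "m \<le> n" for k m
    using sorted that len by (auto simp: sorted_wrt_iff_nth_less n_def)
  have "xs ! 0 = 0"
  proof -
    obtain i where i: "xs ! i = 0" "i \<le> n" using assms(2) F by force
    moreover have "0 \<le> xs ! 0" using F assms(3) by auto
    ultimately show ?thesis using mono[of 0 i] by (cases "i = 0") auto
  qed
  moreover have "xs ! n \<le> T" using F assms(3) by auto
  ultimately show thesis using that[of "(!) xs" n] mono F by auto
qed

context almost_flow
begin

text \<open>All constants come before F. Neighbouring points of F may be further apart than h; such
  a jump is charged only with the growth of one map, and the error estimate is claimed for close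
  pairs alone. The weight \<open>1 + norm (v s)\<close> is absorbed into the constant through the
  bound M.\<close>

lemma euler_on_finite_set:
  fixes x0 :: 'v
  obtains K h M where "0 \<le> K" "0 < h"
    "\<And>F. finite F \<Longrightarrow> 0 \<in> F \<Longrightarrow> F \<subseteq> {0..T} \<Longrightarrow>
       \<exists>v. v 0 = x0 \<and> (\<forall>t. norm (v t) \<le> M) \<and>
         (\<forall>s\<in>F. \<forall>t\<in>F. s < t \<and> t - s \<le> h \<longrightarrow> norm (v t - L s t (v s)) \<le> K * (t - s) powr \<mu>)"
proof -
  obtain K h where K: "0 \<le> K" and h: "0 < h" and loc:
    "\<And>(p::nat \<Rightarrow> real) u n i j. \<lbrakk>0 \<le> p 0; \<And>k. k < n \<Longrightarrow> p k < p (Suc k); p n \<le> T;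
       \<And>k. k < n \<Longrightarrow> u (Suc k) = L (p k) (p (Suc k)) (u k); i < j; j \<le> n; p j - p i \<le> h\<rbrakk> \<Longrightarrow>
       norm (u j - L (p i) (p j) (u i)) \<le> K * (p j - p i) powr \<mu> * (1 + norm (u i)) \<and>
       1 + norm (u j) \<le> 2 * (1 + norm (u i))"
    using euler_local_error by metis
  \<comment> \<open>A stretch of length at most h costs the factor 2 of the local estimate; the
    single, possibly long, step leading into it costs at most
    \<open>1 + C * T powr \<alpha>\<close>.\<close>
  define G where "G = 2 * (1 + C * T powr \<alpha>)"
  have G: "2 \<le> G" using C_nonneg by (simp add: G_def)
  define N where "N = nat \<lceil>T / h\<rceil>"
  have N: "T \<le> real N * h"
    using h T_nonneg by (simp add: N_def pos_divide_le_eq[symmetric])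
  define M where "M = G ^ N * (1 + norm x0)"
  show thesis
  proof (rule that[of "K * M" h M])
    show "0 \<le> K * M" using K G by (simp add: M_def)
    show "0 < h" by (rule h)
    fix F :: "real set"
    assume F: "finite F" "0 \<in> F" "F \<subseteq> {0..T}"
    obtain p :: "nat \<Rightarrow> real" and n where p0: "p 0 = 0" and pS: "\<And>k. k < n \<Longrightarrow> p k < p (Suc k)"
      and pn: "p n \<le> T" and Fp: "F = p ` {..n}"
      using strict_enumeration[OF F] by metis
    have p_less: "p k < p m" if "k < m" "m \<le> n" for k m
      using strict_mono_upto[of n p k m] pS that by blast
    have p_le: "0 \<le> p k" "p k \<le> T" if "k \<le> n" for k
      using that Fp F(3) by auto
    define u where "u = rec_nat x0 (\<lambda>k y. L (p k) (p (Suc k)) y)"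
    have u0: "u 0 = x0" and uS: "u (Suc k) = L (p k) (p (Suc k)) (u k)" for k
      by (simp_all add: u_def)
    have loc': "norm (u j - L (p i) (p j) (u i)) \<le> K * (p j - p i) powr \<mu> * (1 + norm (u i))"
       "1 + norm (u j) \<le> 2 * (1 + norm (u i))" if "i < j" "j \<le> n" "p j - p i \<le> h" for i j
      using loc[of p n u i j] p0 pS pn uS that by simp_all
    have bound: "1 + norm (u j) \<le> G ^ k * (1 + norm x0)" if "j \<le> n" "p j \<le> real k * h" for j k
      using that
    proof (induction k arbitrary: j)
      case 0
      then have "j = 0" using p_less[of 0 j] p0 by (cases "j = 0") auto
      then show ?case by (simp add: u0)
    next
      case (Suc k)
      have Gk: "1 \<le> G ^ k" using G by simp
      show ?case
      proof (cases "p j - p 0 \<le> h")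
        case True
        have "1 + norm (u j) \<le> 2 * (1 + norm (u 0))"
          using loc'(2)[of 0 j] Suc.prems True by (cases "j = 0") auto
        also have "\<dots> \<le> G ^ Suc k * (1 + norm x0)"
          unfolding u0 using mult_mono[OF G Gk] G by (intro mult_right_mono) auto
        finally show ?thesis .
      next
        case False
        \<comment> \<open>i is the last index at distance more than h from j. Hence
          \<open>p i\<close> falls under the induction hypothesis, one jump leads to i + 1, and the
          rest has length at most h.\<close>
        from ex_least_nat_less[of "\<lambda>i. p j - p i \<le> h" j, OF _ False] h obtain i
          where i: "i < j" "\<not> p j - p i \<le> h" "p j - p (Suc i) \<le> h" by auto
        have "p i \<le> real k * h" using i Suc.prems by (simp add: algebra_simps)
        then have ui: "1 + norm (u i) \<le> G ^ k * (1 + norm x0)"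
          using Suc.IH[of i] i Suc.prems by simp
        have "1 + norm (u (Suc i)) \<le> (1 + C * (p (Suc i) - p i) powr \<alpha>) * (1 + norm (u i))"
          unfolding uS using p_le[of i] p_le[of "Suc i"] p_less[of i "Suc i"] i Suc.prems
          by (intro growth) auto
        also have "\<dots> \<le> (1 + C * T powr \<alpha>) * (1 + norm (u i))"
          using p_le[of i] p_le[of "Suc i"] p_less[of i "Suc i"] i Suc.prems C_nonneg \<alpha>_pos
          by (intro mult_right_mono add_left_mono mult_left_mono powr_mono2) auto
        finally have "2 * (1 + norm (u (Suc i))) \<le> 2 * ((1 + C * T powr \<alpha>) * (1 + norm (u i)))"
          by (rule mult_left_mono) simp
        then have "2 * (1 + norm (u (Suc i))) \<le> G * (1 + norm (u i))"
          by (simp only: G_def mult.assoc)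
        moreover have "1 + norm (u j) \<le> 2 * (1 + norm (u (Suc i)))"
          using loc'(2)[of "Suc i" j] i Suc.prems by (cases "Suc i = j") auto
        moreover have "G * (1 + norm (u i)) \<le> G * (G ^ k * (1 + norm x0))"
          using ui G by (intro mult_left_mono) auto
        ultimately show ?thesis by (simp add: mult.assoc)
      qed
    qed
    have M: "1 + norm (u j) \<le> M" if "j \<le> n" for j
      unfolding M_def using bound[OF that, of N] p_le[OF that] N by simp
    have "\<forall>t\<in>F. \<exists>k\<le>n. p k = t" using Fp by auto
    then obtain k where k: "\<And>t. t \<in> F \<Longrightarrow> k t \<le> n \<and> p (k t) = t" by metis
    \<comment> \<open>Outside F the value is a filler that respects the bound M, so that v lies in
      the product of balls.\<close>
    define v where "v t = (if t \<in> F then u (k t) else x0)" for t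
    have "k 0 = 0" using k[OF F(2)] p_less[of 0 "k 0"] p0 by (cases "k 0 = 0") auto
    then have "v 0 = x0" using F(2) u0 by (simp add: v_def)
    moreover have "norm (v t) \<le> M" for t
      using M[of "k t"] k[of t] M[of 0] u0 by (auto simp: v_def)
    moreover have "norm (v t - L s t (v s)) \<le> K * M * (t - s) powr \<mu>"
      if "s \<in> F" "t \<in> F" "s < t" "t - s \<le> h" for s t
    proof -
      have "k s < k t"
        using k[OF that(1)] k[OF that(2)] p_less[of "k t" "k s"] that(3) by (cases "k s" "k t" rule: linorder_cases) auto
      then have "norm (v t - L s t (v s)) \<le> K * (t - s) powr \<mu> * (1 + norm (v s))"
        using loc'(1)[of "k s" "k t"] k[OF that(1)] k[OF that(2)] that by (simp add: v_def)
      also have "\<dots> \<le> K * (t - s) powr \<mu> * M"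
        using M[of "k s"] k[OF that(1)] that(1) K by (intro mult_left_mono) (auto simp: v_def)
      finally show ?thesis by (simp add: mult_ac)
    qed
    ultimately show "\<exists>v. v 0 = x0 \<and> (\<forall>t. norm (v t) \<le> M) \<and>
         (\<forall>s\<in>F. \<forall>t\<in>F. s < t \<and> t - s \<le> h \<longrightarrow> norm (v t - L s t (v s)) \<le> K * M * (t - s) powr \<mu>)"
      by blast
  qed
qed

lemma step_diff:
  assumes "0 \<le> s" "s < t" "t \<le> T"
  shows "L s t x - L s t y = L s t (x - y) - L s t 0"
  using linear_diff[OF affine[OF assms], of x y] by simp

lemma continuous_on_step:
  assumes "0 \<le> s" "s < t" "t \<le> T"
  shows "continuous_on UNIV (L s t)"
proof -
  have "continuous_on UNIV (\<lambda>x. L s t x - L s t 0)"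
    using affine[OF assms] by (intro linear_continuous_on linear_conv_bounded_linear[THEN iffD1])
  from continuous_on_add[OF this continuous_on_const, of "L s t 0"] show ?thesis by simp
qed

text \<open>The Euler schemes on finite sets of times satisfy every closed constraint that involves only these
  times; by Tychonoff's theorem all constraints can be met at once.\<close>

theorem flow_exists:
  obtains u M where "u 0 = x0" "\<And>t. norm (u t) \<le> M" "small_order T \<mu> (\<lambda>s t. u t - L s t (u s))"
proof -
  obtain K h M where K: "0 \<le> K" and h: "0 < h" and euler:
    "\<And>F. finite F \<Longrightarrow> 0 \<in> F \<Longrightarrow> F \<subseteq> {0..T} \<Longrightarrow>
       \<exists>v. v 0 = x0 \<and> (\<forall>t. norm (v t) \<le> M) \<and>
         (\<forall>s\<in>F. \<forall>t\<in>F. s < t \<and> t - s \<le> h \<longrightarrow> norm (v t - L s t (v s)) \<le> K * (t - s) powr \<mu>)"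
    using euler_on_finite_set by metis
  define S :: "(real \<Rightarrow> 'v) set" where "S = PiE UNIV (\<lambda>_. cball 0 M)"
  define P where "P = {(s, t). 0 \<le> s \<and> s < t \<and> t \<le> T \<and> t - s \<le> h}"
  \<comment> \<open>The initial value is part of every constraint and so survives in the
    intersection as soon as there is one pair; there is none only if T = 0.\<close>
  define A where "A = (\<lambda>(s, t). {v. v 0 = x0 \<and> norm (v t - L s t (v s)) \<le> K * (t - s) powr \<mu>})"
  have "compact S"
    using compactin_PiE[of "\<lambda>_. euclidean :: 'v topology" "UNIV :: real set" "\<lambda>_. cball 0 M"]
    by (auto simp: S_def euclidean_product_topology)
  moreover have "closed (A z)" if z: "z \<in> P" for z
  proof -
    obtain s t where st: "z = (s, t)" "0 \<le> s" "s < t" "t \<le> T" using z by (auto simp: P_def)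
    have "continuous_on UNIV (\<lambda>v :: real \<Rightarrow> 'v. L s t (v s))"
      by (rule continuous_on_compose2[OF continuous_on_step[OF st(2-4)] continuous_on_product_coordinates]) simp
    then show ?thesis unfolding A_def st(1) prod.case
      by (intro closed_Collect_conj closed_Collect_eq closed_Collect_le continuous_intros
            continuous_on_product_coordinates)
  qed
  moreover have "S \<inter> (\<Inter>z\<in>Q. A z) \<noteq> {}" if Q: "finite Q" "Q \<subseteq> P" for Q
  proof -
    let ?F = "insert 0 (fst ` Q \<union> snd ` Q)"
    have "?F \<subseteq> {0..T}" using Q T_nonneg by (auto simp: P_def)
    with euler[of ?F] Q obtain v where v: "v 0 = x0" "\<And>t. norm (v t) \<le> M"
      "\<And>s t. s \<in> ?F \<Longrightarrow> t \<in> ?F \<Longrightarrow> s < t \<Longrightarrow> t - s \<le> h \<Longrightarrow> norm (v t - L s t (v s)) \<le> K * (t - s) powr \<mu>"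
      by blast
    have "v \<in> A (s, t)" if "(s, t) \<in> Q" for s t
    proof -
      have "s \<in> ?F" "t \<in> ?F" using that by force+
      then show ?thesis using v(1) v(3)[of s t] that Q by (auto simp: A_def P_def)
    qed
    then have "v \<in> S \<inter> (\<Inter>z\<in>Q. A z)" using v(2) by (auto simp: S_def)
    then show ?thesis by blast
  qed
  \<comment> \<open>The finite intersection property gives the second alternative; either one
    provides a point of S that meets all constraints.\<close>
  ultimately have "S \<inter> (\<Inter>z\<in>insert (0, 0) P. A z) \<noteq> {} \<or> S \<inter> (\<Inter>z\<in>P. A z) \<noteq> {}"
    using compact_imp_fip_image[of S P A] by blast
  then obtain v where v: "\<And>s t. (s, t) \<in> P \<Longrightarrow> v \<in> A (s, t)" and "v \<in> S" by blast
  then have M: "norm (v t) \<le> M" for t by (auto simp: S_def)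
  show thesis
  proof (cases "P = {}")
    case True
    have "T = 0"
    proof (rule ccontr)
      assume "T \<noteq> 0"
      then have "(0, min h T) \<in> P" using h T_nonneg by (auto simp: P_def)
      with True show False by simp
    qed
    then have "small_order T \<mu> (\<lambda>s t. x0 - L s t x0)"
      unfolding small_order_def by (intro exI[of _ 0] exI[of _ 1]) auto
    then show thesis using that[of "\<lambda>_. x0" "norm x0"] by simp
  next
    case False
    have "small_order T \<mu> (\<lambda>s t. v t - L s t (v s))"
      unfolding small_order_def by (rule exI[of _ K], rule exI[of _ h]) (use v K h in \<open>auto simp: P_def A_def\<close>)
    moreover have "v 0 = x0" using False v by (auto simp: A_def)
    ultimately show thesis using that M by blast
  qed
qed

text \<open>For pairs further apart than h, the power of t - s is bounded below by that of h, so
  boundedness of u suffices. The Hoelder classes ask for the estimate on all pairs.\<close>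

lemma global_error:
  assumes bound: "\<And>t. norm (u t) \<le> M" and so: "small_order T \<mu> (\<lambda>s t. u t - L s t (u s))"
  obtains K where "0 \<le> K"
    "\<And>s t. 0 \<le> s \<Longrightarrow> s < t \<Longrightarrow> t \<le> T \<Longrightarrow> norm (u t - L s t (u s)) \<le> K * (t - s) powr \<mu>"
proof -
  obtain K h where K: "0 \<le> K" "0 < h" "\<And>s t. 0 \<le> s \<Longrightarrow> s < t \<Longrightarrow> t \<le> T \<Longrightarrow> t - s \<le> h \<Longrightarrow>
      norm (u t - L s t (u s)) \<le> K * (t - s) powr \<mu>" using so unfolding small_order_def by blast
  have M: "0 \<le> M" using order_trans[OF norm_ge_zero bound] .
  define B where "B = M + (1 + C * T powr \<alpha>) * (1 + M)"
  have B: "0 \<le> B" using M C_nonneg by (simp add: B_def)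
  have uB: "norm (u t - L s t (u s)) \<le> B" if "0 \<le> s" "s < t" "t \<le> T" for s t
  proof -
    have "norm (L s t (u s)) \<le> (1 + C * (t - s) powr \<alpha>) * (1 + norm (u s))"
      using growth[OF that, of "u s"] by simp
    also have "\<dots> \<le> (1 + C * T powr \<alpha>) * (1 + M)"
      using that C_nonneg \<alpha>_pos bound
      by (intro mult_mono add_left_mono mult_left_mono powr_mono2) auto
    finally show ?thesis
      using norm_triangle_ineq4[of "u t" "L s t (u s)"] bound[of t] by (simp add: B_def)
  qed
  show thesis
  proof (rule that[of "K + B / h powr \<mu>"])
    show "0 \<le> K + B / h powr \<mu>" using K B by simp
    fix s t assume st: "0 \<le> s" "s < t" "t \<le> T"
    show "norm (u t - L s t (u s)) \<le> (K + B / h powr \<mu>) * (t - s) powr \<mu>"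
    proof (cases "t - s \<le> h")
      case True
      then show ?thesis using K(3)[OF st] B
        by (simp add: distrib_right add_increasing2)
    next
      case False
      have "norm (u t - L s t (u s)) \<le> B / h powr \<mu> * h powr \<mu>" using uB[OF st] K(2) by simp
      also have "\<dots> \<le> B / h powr \<mu> * (t - s) powr \<mu>"
        using False K(2) B \<mu>_gt_1 by (intro mult_left_mono powr_mono2) auto
      finally show ?thesis using K(1) by (simp add: distrib_right add_increasing)
    qed
  qed
qed

text \<open>The error e of the difference z is taken relative to the linear parts of the maps.
  Splitting at the midpoint leaves two errors at half scale and a difference of defects,
  proportional to \<open>z s\<close>. As z vanishes at the start s0 of the window,
  \<open>z s\<close> equals \<open>e s0 s\<close>; so every term carries the current constant, which
  therefore shrinks by a fixed factor. Iteration gives e = 0. No bound on u and v is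
  involved.\<close>

theorem flow_unique:
  assumes eq0: "u 0 = v 0" and u: "small_order T \<mu> (\<lambda>s t. u t - L s t (u s))"
    and v: "small_order T \<mu> (\<lambda>s t. v t - L s t (v s))" and t: "0 \<le> t" "t \<le> T"
  shows "u t = v t"
proof -
  obtain K1 h1 where 1: "0 \<le> K1" "0 < h1" "\<And>s t. 0 \<le> s \<Longrightarrow> s < t \<Longrightarrow> t \<le> T \<Longrightarrow> t - s \<le> h1 \<Longrightarrow>
      norm (u t - L s t (u s)) \<le> K1 * (t - s) powr \<mu>" using u unfolding small_order_def by blast
  obtain K2 h2 where 2: "0 \<le> K2" "0 < h2" "\<And>s t. 0 \<le> s \<Longrightarrow> s < t \<Longrightarrow> t \<le> T \<Longrightarrow> t - s \<le> h2 \<Longrightarrow>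
      norm (v t - L s t (v s)) \<le> K2 * (t - s) powr \<mu>" using v unfolding small_order_def by blast
  define z where "z t = u t - v t" for t
  define e where "e s t = z t - (L s t (u s) - L s t (v s))" for s t
  define q where "q = 2 powr (1 - \<mu>)"
  have q: "0 < q" "q < 1"
    using powr_less_mono[of "1 - \<mu>" 0 2] \<mu>_gt_1 by (auto simp: q_def)
  obtain h3 where h3: "0 < h3" "\<And>d. 0 < d \<Longrightarrow> d \<le> h3 \<Longrightarrow> C * d powr \<alpha> + C * d powr \<mu> \<le> (1 - q) / 2"
    using ex_small_powr[of \<alpha> \<mu> "(1 - q) / 2" C C] \<alpha>_pos \<mu>_gt_1 q C_nonneg by auto
  \<comment> \<open>The window length depends only on the constants and not on where the window
    starts, so finitely many windows cover the horizon.\<close>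
  define h where "h = min (min h1 h2) h3"
  have h: "0 < h" "h \<le> h1" "h \<le> h2" "h \<le> h3" using 1 2 h3 by (auto simp: h_def)
  \<comment> \<open>\<rho> is halfway between q and 1; the threshold h3 was chosen so that the gap
    \<rho> - q pays for the Lipschitz factor and for the defects.\<close>
  define \<rho> where "\<rho> = (1 + q) / 2"
  have \<rho>: "0 < \<rho>" "\<rho> < 1" using q by (auto simp: \<rho>_def)
  have local: "z t = 0" if s0: "0 \<le> s0" "z s0 = 0" and t: "s0 \<le> t" "t \<le> T" "t - s0 \<le> h" for s0 t
  proof -
    define b where "b = s0 + h"
    have err: "norm (e s t) \<le> (K1 + K2) * \<rho> ^ n * (t - s) powr \<mu>"
      if "s0 \<le> s" "s < t" "t \<le> b" "t \<le> T" for n s t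
      using that
    proof (induction n arbitrary: s t)
      case 0
      have "norm (e s t) \<le> norm (u t - L s t (u s)) + norm (v t - L s t (v s))"
        using norm_triangle_ineq4[of "u t - L s t (u s)" "v t - L s t (v s)"]
        by (simp add: e_def z_def algebra_simps)
      also have "\<dots> \<le> K1 * (t - s) powr \<mu> + K2 * (t - s) powr \<mu>"
        using 0 s0 h by (intro add_mono 1 2) (auto simp: b_def)
      finally show ?case by (simp add: algebra_simps)
    next
      case (Suc n)
      define \<kappa> where "\<kappa> = (K1 + K2) * \<rho> ^ n"
      have \<kappa>: "0 \<le> \<kappa>" using 1 2 \<rho> by (simp add: \<kappa>_def)
      have IH: "norm (e s t) \<le> \<kappa> * (t - s) powr \<mu>" if "s0 \<le> s" "s < t" "t \<le> b" "t \<le> T" for s t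
        using Suc.IH that by (simp add: \<kappa>_def)
      define r where "r = (s + t) / 2"
      define d where "d = t - s"
      define D where "D = d powr \<mu>"
      have r: "s < r" "r < t" "r - s = d / 2" "t - r = d / 2" and d: "0 < d" "d \<le> h"
        using Suc.prems s0 by (auto simp: r_def d_def b_def field_simps)
      have D: "0 \<le> D" by (simp add: D_def)
      have half: "(d / 2) powr \<mu> = q / 2 * D"
        using d by (simp add: D_def q_def powr_divide powr_diff field_simps)
      have Ca: "C * (d / 2) powr \<alpha> \<le> C * d powr \<alpha>"
        using d C_nonneg \<alpha>_pos by (intro mult_left_mono powr_mono2) auto
      have Ch: "C * d powr \<alpha> + C * h powr \<mu> \<le> (1 - q) / 2"
      proof -
        have "d powr \<alpha> \<le> h powr \<alpha>" using d \<alpha>_pos by (intro powr_mono2) auto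
        then have "C * d powr \<alpha> \<le> C * h powr \<alpha>" using C_nonneg by (intro mult_left_mono)
        then show ?thesis using h3(2)[of h] h by linarith
      qed
      have zs: "norm (z s) \<le> \<kappa> * h powr \<mu>"
      proof (cases "s = s0")
        case False
        have "norm (z s) = norm (e s0 s)" using s0 by (simp add: e_def z_def)
        also have "\<dots> \<le> \<kappa> * (s - s0) powr \<mu>" using False Suc.prems by (intro IH) auto
        also have "\<dots> \<le> \<kappa> * h powr \<mu>"
          using False Suc.prems \<kappa> \<mu>_gt_1 by (intro mult_left_mono powr_mono2) (auto simp: b_def)
        finally show ?thesis .
      qed (use s0 \<kappa> in simp)
      \<comment> \<open>w makes \<open>z r - w\<close> equal to \<open>e s r\<close>. By affinity,
        differences of values of \<open>L r t\<close> depend only on the differences of the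
        arguments.\<close>
      define w where "w = (L s r (u s) - L s r (v s))"
      have "e s t = e r t + (L r t (z r) - L r t w)
          + ((L r t (L s r (u s)) - L s t (u s)) - (L r t (L s r (v s)) - L s t (v s)))"
        using step_diff[of r t "u r" "v r"] step_diff[of r t "L s r (u s)" "L s r (v s)"] s0 r Suc.prems
        by (simp add: e_def z_def w_def)
      then have "norm (e s t) \<le> norm (e r t) + norm (L r t (z r) - L r t w)
          + norm ((L r t (L s r (u s)) - L s t (u s)) - (L r t (L s r (v s)) - L s t (v s)))"
        by (metis (no_types, lifting) norm_triangle_ineq norm_triangle_le add_right_mono)
      also have "\<dots> \<le> \<kappa> * (q / 2 * D) + (1 + C * d powr \<alpha>) * (\<kappa> * (q / 2 * D)) + C * D * (\<kappa> * h powr \<mu>)"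
      proof (intro add_mono)
        show "norm (e r t) \<le> \<kappa> * (q / 2 * D)"
          using IH[of r t] r Suc.prems by (simp add: half)
        have "norm (L r t (z r) - L r t w) \<le> (1 + C * (d / 2) powr \<alpha>) * norm (e s r)"
          using lipschitz[of r t "z r" w] r s0 Suc.prems by (simp add: e_def w_def)
        also have "\<dots> \<le> (1 + C * d powr \<alpha>) * (\<kappa> * (q / 2 * D))"
          using Ca IH[of s r] r Suc.prems C_nonneg by (intro mult_mono) (auto simp: half)
        finally show "norm (L r t (z r) - L r t w) \<le> (1 + C * d powr \<alpha>) * (\<kappa> * (q / 2 * D))" .
        have "norm ((L r t (L s r (u s)) - L s t (u s)) - (L r t (L s r (v s)) - L s t (v s)))
            \<le> C * D * norm (z s)"
          using defect_lipschitz[of s r t "u s" "v s"] r s0 Suc.prems by (simp add: D_def d_def z_def)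
        also have "\<dots> \<le> C * D * (\<kappa> * h powr \<mu>)"
          using zs C_nonneg D by (intro mult_left_mono) auto
        finally show "norm ((L r t (L s r (u s)) - L s t (u s)) - (L r t (L s r (v s)) - L s t (v s)))
            \<le> C * D * (\<kappa> * h powr \<mu>)" .
      qed
      also have "\<dots> = \<kappa> * D * (q + C * d powr \<alpha> * (q / 2) + C * h powr \<mu>)"
        by (simp add: field_simps)
      also have "\<dots> \<le> \<kappa> * D * \<rho>"
      proof (intro mult_left_mono)
        have "C * d powr \<alpha> * (q / 2) \<le> C * d powr \<alpha> * 1"
          using q C_nonneg by (intro mult_left_mono) auto
        then show "q + C * d powr \<alpha> * (q / 2) + C * h powr \<mu> \<le> \<rho>"
          using Ch by (simp add: \<rho>_def field_simps)
      qed (use \<kappa> D in simp)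
      finally show ?case by (simp add: \<kappa>_def D_def d_def mult_ac)
    qed
    show ?thesis
    proof (cases "t = s0")
      case False
      have "(\<lambda>n. (K1 + K2) * \<rho> ^ n * (t - s0) powr \<mu>) \<longlonglongrightarrow> (K1 + K2) * 0 * (t - s0) powr \<mu>"
        using \<rho> by (intro tendsto_intros LIMSEQ_realpow_zero) auto
      then have "norm (e s0 t) \<le> (K1 + K2) * 0 * (t - s0) powr \<mu>"
        by (rule LIMSEQ_le_const) (use err[of s0 t] False t in \<open>auto simp: b_def simp del: mult_le_cancel_right\<close>)
      then show ?thesis using s0 by (simp add: e_def z_def)
    qed (use s0 in simp)
  qed
  have steps: "z t = 0" if "0 \<le> t" "t \<le> T" "t \<le> real n * h" for n t
    using that
  proof (induction n arbitrary: t)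
    case 0
    then show ?case using eq0 by (simp add: z_def)
  next
    case (Suc n)
    define s0 where "s0 = min t (real n * h)"
    have "z s0 = 0" using Suc.prems h by (intro Suc.IH) (auto simp: s0_def)
    moreover have "0 \<le> s0" "s0 \<le> t" using Suc.prems h by (auto simp: s0_def)
    moreover have "t - s0 \<le> h" using Suc.prems(3) h by (auto simp: s0_def distrib_right)
    ultimately show ?case using local[of s0 t] Suc.prems(2) by blast
  qed
  have "t \<le> real (nat \<lceil>t / h\<rceil>) * h"
    using h t by (simp add: pos_divide_le_eq[symmetric])
  then show ?thesis using steps[OF t] by (simp add: z_def)
qed

end

section \<open>Sewing and partition limits\<close>

lemma small_order_add:
  assumes "small_order T \<mu> f" "small_order T \<mu> g"
  shows "small_order T \<mu> (\<lambda>s t. f s t + g s t)"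
proof -
  obtain K1 h1 where 1: "0 \<le> K1" "0 < h1" "\<And>s t. 0 \<le> s \<Longrightarrow> s < t \<Longrightarrow> t \<le> T \<Longrightarrow> t - s \<le> h1 \<Longrightarrow>
      norm (f s t) \<le> K1 * (t - s) powr \<mu>" using assms(1) unfolding small_order_def by blast
  obtain K2 h2 where 2: "0 \<le> K2" "0 < h2" "\<And>s t. 0 \<le> s \<Longrightarrow> s < t \<Longrightarrow> t \<le> T \<Longrightarrow> t - s \<le> h2 \<Longrightarrow>
      norm (g s t) \<le> K2 * (t - s) powr \<mu>" using assms(2) unfolding small_order_def by blast
  have "norm (f s t + g s t) \<le> (K1 + K2) * (t - s) powr \<mu>"
    if "0 \<le> s" "s < t" "t \<le> T" "t - s \<le> min h1 h2" for s t
    using 1(3)[of s t] 2(3)[of s t] that norm_triangle_ineq[of "f s t" "g s t"]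
    by (simp add: distrib_right)
  then show ?thesis
    unfolding small_order_def using 1 2 by (intro exI[of _ "K1 + K2"] exI[of _ "min h1 h2"]) auto
qed

lemma small_order_uminus:
  assumes "small_order T \<mu> f"
  shows "small_order T \<mu> (\<lambda>s t. - f s t)"
  using assms by (simp add: small_order_def)

lemma small_order_diff:
  assumes "small_order T \<mu> f" "small_order T \<mu> g"
  shows "small_order T \<mu> (\<lambda>s t. f s t - g s t)"
  using small_order_add[OF assms(1) small_order_uminus[OF assms(2)]] by simp

lemma small_order_zero: "small_order T \<mu> (\<lambda>s t. 0)"
  unfolding small_order_def by (intro exI[of _ 0] exI[of _ 1]) auto

lemma small_order_sum:
  assumes "finite A" "\<And>i. i \<in> A \<Longrightarrow> small_order T \<mu> (f i)"
  shows "small_order T \<mu> (\<lambda>s t. \<Sum>i\<in>A. f i s t)"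
  using assms by (induction) (auto intro: small_order_zero small_order_add)

lemma small_order_cong:
  assumes "\<And>s t. 0 \<le> s \<Longrightarrow> s < t \<Longrightarrow> t \<le> T \<Longrightarrow> f s t = g s t"
  shows "small_order T \<mu> f \<longleftrightarrow> small_order T \<mu> g"
  using assms by (auto simp: small_order_def)

section \<open>Limits along partitions\<close>

lemma partition_bounds:
  fixes p :: "nat \<Rightarrow> real"
  assumes "\<forall>k<n. p k < p (Suc k)" "k < n"
  shows "p 0 \<le> p k" "p (Suc k) \<le> p n"
proof -
  show "p 0 \<le> p k" using strict_mono_upto[of n p 0 k] assms by (cases "k = 0") auto
  show "p (Suc k) \<le> p n" using strict_mono_upto[of n p "Suc k" n] assms by (cases "Suc k = n") auto
qed

text \<open>Integrands are only known inside the horizon; the points of a partition increase from 0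
  to t and hence never leave it.\<close>

lemma has_partition_limit_cong:
  assumes "\<And>u v. 0 \<le> u \<Longrightarrow> u < v \<Longrightarrow> v \<le> t \<Longrightarrow> \<Xi> u v = \<Xi>' u v"
  shows "has_partition_limit \<Xi> t I \<longleftrightarrow> has_partition_limit \<Xi>' t I"
proof -
  have "(p 0 = 0 \<and> p n = t \<and> (\<forall>k<n. p k < p (Suc k) \<and> p (Suc k) - p k < \<delta>) \<longrightarrow>
          norm ((\<Sum>k<n. \<Xi> (p k) (p (Suc k))) - I) < \<epsilon>) \<longleftrightarrow>
        (p 0 = 0 \<and> p n = t \<and> (\<forall>k<n. p k < p (Suc k) \<and> p (Suc k) - p k < \<delta>) \<longrightarrow>
          norm ((\<Sum>k<n. \<Xi>' (p k) (p (Suc k))) - I) < \<epsilon>)" for n \<delta> \<epsilon> and p :: "nat \<Rightarrow> real"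
  proof (intro imp_cong refl)
    assume "p 0 = 0 \<and> p n = t \<and> (\<forall>k<n. p k < p (Suc k) \<and> p (Suc k) - p k < \<delta>)"
    then have "(\<Sum>k<n. \<Xi> (p k) (p (Suc k))) = (\<Sum>k<n. \<Xi>' (p k) (p (Suc k)))"
      using partition_bounds[of n p] assms by (intro sum.cong) auto
    then show "norm ((\<Sum>k<n. \<Xi> (p k) (p (Suc k))) - I) < \<epsilon> \<longleftrightarrow>
        norm ((\<Sum>k<n. \<Xi>' (p k) (p (Suc k))) - I) < \<epsilon>" by simp
  qed
  then show ?thesis unfolding has_partition_limit_def by simp
qed

lemma has_partition_limit_zero: "has_partition_limit (\<lambda>u v. 0) t 0"
  unfolding has_partition_limit_def by (auto intro: exI[of _ 1])

lemma has_partition_limit_unique: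
  assumes "0 \<le> t" "has_partition_limit \<Xi> t I" "has_partition_limit \<Xi> t J"
  shows "I = J"
proof (rule ccontr)
  assume "I \<noteq> J"
  define e where "e = norm (I - J) / 2"
  have e: "0 < e" using \<open>I \<noteq> J\<close> by (simp add: e_def)
  obtain d1 where d1: "d1 > 0" "\<And>n p. p 0 = 0 \<Longrightarrow> p n = t \<Longrightarrow> (\<forall>k<n. p k < p (Suc k) \<and> p (Suc k) - p k < d1) \<Longrightarrow>
    norm ((\<Sum>k<n. \<Xi> (p k) (p (Suc k))) - I) < e"
    using assms(2) e unfolding has_partition_limit_def by meson
  obtain d2 where d2: "d2 > 0" "\<And>n p. p 0 = 0 \<Longrightarrow> p n = t \<Longrightarrow> (\<forall>k<n. p k < p (Suc k) \<and> p (Suc k) - p k < d2) \<Longrightarrow>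
    norm ((\<Sum>k<n. \<Xi> (p k) (p (Suc k))) - J) < e"
    using assms(3) e unfolding has_partition_limit_def by meson
  \<comment> \<open>A partition finer than both thresholds: the trivial one with n = 0 at time 0,
    otherwise a uniform one. The 1 added to the ceiling makes its mesh strictly smaller.\<close>
  obtain n and p :: "nat \<Rightarrow> real" where p: "p 0 = 0" "p n = t" "\<forall>k<n. p k < p (Suc k) \<and> p (Suc k) - p k < min d1 d2"
  proof (cases "t = 0")
    case True
    then show thesis using that[of "\<lambda>_. 0" 0] by simp
  next
    case False
    then have t: "0 < t" using assms by simp
    define n where "n = nat \<lceil>t / min d1 d2\<rceil> + 1"
    have "t / min d1 d2 < real n" unfolding n_def by linarith
    moreover have "0 < min d1 d2" "0 < n" using d1 d2 by (auto simp: n_def)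
    ultimately have n: "t / real n < min d1 d2" "0 < n"
      by (simp_all add: pos_divide_less_eq mult.commute del: min_less_iff_conj)
    have step: "t * real (Suc k) / real n - t * real k / real n = t / real n" for k
      by (simp add: algebra_simps add_divide_distrib diff_divide_distrib[symmetric])
    have "t * real k / real n < t * real (Suc k) / real n" for k
      using step[of k] t n by (smt (verit) divide_pos_pos of_nat_0_less_iff)
    then show thesis using n step by (intro that[of "\<lambda>k. t * real k / real n" n]) simp_all
  qed
  have "norm ((\<Sum>k<n. \<Xi> (p k) (p (Suc k))) - I) < e" "norm ((\<Sum>k<n. \<Xi> (p k) (p (Suc k))) - J) < e"
    using d1(2)[of p n] d2(2)[of p n] p by auto
  then have "norm (I - J) < 2 * e"
    using norm_triangle_ineq4[of "(\<Sum>k<n. \<Xi> (p k) (p (Suc k))) - J" "(\<Sum>k<n. \<Xi> (p k) (p (Suc k))) - I"] by simp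
  then show False by (simp add: e_def)
qed

text \<open>The increments of u telescope, and an error of order \<mu> on each piece is at most the
  length of the piece times the mesh to the power \<mu> - 1. Summation leaves t times a vanishing
  factor.\<close>

lemma has_partition_limit_small_order:
  assumes \<mu>: "1 < \<mu>" and so: "small_order T \<mu> (\<lambda>s t. u t - u s - \<Xi> s t)" and t: "0 \<le> t" "t \<le> T"
  shows "has_partition_limit \<Xi> t (u t - u 0)"
  unfolding has_partition_limit_def
proof (intro allI impI)
  fix e :: real assume e: "e > 0"
  obtain K h where K: "0 \<le> K" "0 < h" "\<And>s t. 0 \<le> s \<Longrightarrow> s < t \<Longrightarrow> t \<le> T \<Longrightarrow> t - s \<le> h \<Longrightarrow>
      norm (u t - u s - \<Xi> s t) \<le> K * (t - s) powr \<mu>" using so unfolding small_order_def by blast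
  obtain h' where h': "0 < h'" "\<And>d. 0 < d \<Longrightarrow> d \<le> h' \<Longrightarrow> K * t * d powr (\<mu> - 1) + 0 * d powr 1 \<le> e / 2"
    using ex_small_powr[of "\<mu> - 1" 1 "e / 2" "K * t" 0] K t \<mu> e by auto
  define d where "d = min h h'"
  have d: "0 < d" "d \<le> h" "K * t * d powr (\<mu> - 1) \<le> e / 2"
    using K(2) h'(1) h'(2)[of d] by (auto simp: d_def)
  have "norm ((\<Sum>k<n. \<Xi> (p k) (p (Suc k))) - (u t - u 0)) < e"
    if p: "p 0 = 0" "p n = t" "\<forall>k<n. p k < p (Suc k) \<and> p (Suc k) - p k < d" for n and p :: "nat \<Rightarrow> real"
  proof -
    have "(\<Sum>k<n. \<Xi> (p k) (p (Suc k))) - (u t - u 0)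
        = (\<Sum>k<n. \<Xi> (p k) (p (Suc k)) - (u (p (Suc k)) - u (p k)))"
      using sum_lessThan_telescope[of "\<lambda>k. u (p k)" n] p by (simp add: sum_subtractf)
    also have "norm \<dots> \<le> (\<Sum>k<n. K * d powr (\<mu> - 1) * (p (Suc k) - p k))"
    proof (rule sum_norm_le)
      fix k assume "k \<in> {..<n}"
      then have k: "k < n" by simp
      have b: "0 \<le> p k" "p (Suc k) \<le> t" using partition_bounds[of n p k] p k by auto
      have s: "p k < p (Suc k)" "p (Suc k) - p k < d" using p k by auto
      have "norm (\<Xi> (p k) (p (Suc k)) - (u (p (Suc k)) - u (p k))) \<le> K * (p (Suc k) - p k) powr \<mu>"
        using K(3)[of "p k" "p (Suc k)"] b s t d
        by (simp add: norm_minus_commute[of "\<Xi> (p k) (p (Suc k))"])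
      also have "(p (Suc k) - p k) powr \<mu> = (p (Suc k) - p k) powr (\<mu> - 1) * (p (Suc k) - p k)"
        using s powr_add[of "p (Suc k) - p k" "\<mu> - 1" 1] by simp
      also have "K * \<dots> \<le> K * (d powr (\<mu> - 1) * (p (Suc k) - p k))"
        using s K \<mu> by (intro mult_left_mono mult_right_mono powr_mono2) auto
      finally show "norm (\<Xi> (p k) (p (Suc k)) - (u (p (Suc k)) - u (p k)))
          \<le> K * d powr (\<mu> - 1) * (p (Suc k) - p k)" by (simp add: mult_ac)
    qed
    also have "\<dots> = K * t * d powr (\<mu> - 1)"
      using sum_lessThan_telescope[of p n] p by (simp add: sum_distrib_left[symmetric])
    also have "\<dots> < e" using d e by simp
    finally show ?thesis .
  qed
  then show "\<exists>\<delta>>0. \<forall>n p. p 0 = 0 \<and> p n = t \<and> (\<forall>k<n. p k < p (Suc k) \<and> p (Suc k) - p k < \<delta>) \<longrightarrow>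
      norm ((\<Sum>k<n. \<Xi> (p k) (p (Suc k))) - (u t - u 0)) < e"
    using d(1) by (intro exI[of _ d]) simp
qed

text \<open>Such an f is a primitive of the zero germ up to an order above 1, so its increment is
  the partition limit of 0.\<close>

lemma small_order_increments_const:
  assumes "1 < \<mu>" "small_order T \<mu> (\<lambda>s t. f t - f s)" "0 \<le> t" "t \<le> T"
  shows "f t = f 0"
proof -
  have "has_partition_limit (\<lambda>s t. 0) t (f t - f 0)"
    using assms by (intro has_partition_limit_small_order[where u = f and \<mu> = \<mu> and T = T]) simp_all
  with has_partition_limit_unique[OF \<open>0 \<le> t\<close> this has_partition_limit_zero] show ?thesis by simp
qed

text \<open>The defect of translations does not depend on the state, so the plain bounds imply the
  weighted ones. Only existence is recorded; later, uniqueness is taken from that of partition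
  limits.\<close>

theorem additive_sewing:
  fixes \<Xi> :: "real \<Rightarrow> real \<Rightarrow> 'v::euclidean_space"
  assumes "0 \<le> T" "0 \<le> C" "0 < \<alpha>" "1 < \<mu>"
    and "\<And>s t. 0 \<le> s \<Longrightarrow> s < t \<Longrightarrow> t \<le> T \<Longrightarrow> norm (\<Xi> s t) \<le> C * (t - s) powr \<alpha>"
    and "\<And>s r t. 0 \<le> s \<Longrightarrow> s < r \<Longrightarrow> r < t \<Longrightarrow> t \<le> T \<Longrightarrow>
          norm (\<Xi> s r + \<Xi> r t - \<Xi> s t) \<le> C * (t - s) powr \<mu>"
  obtains u where "u 0 = 0" "small_order T \<mu> (\<lambda>s t. u t - u s - \<Xi> s t)"
proof -
  have weight: "D \<le> D * (1 + norm x)" if "0 \<le> D" for D and x :: 'v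
    using that by (simp add: distrib_left)
  interpret almost_flow T C \<alpha> \<mu> "\<lambda>s t x. x + \<Xi> s t"
  proof (rule almost_flow.intro)
    fix s t assume st: "0 \<le> s" "s < t" "t \<le> T"
    show "linear (\<lambda>x::'v. x + \<Xi> s t - (0 + \<Xi> s t))" using linear_id by (simp add: id_def)
    fix x :: 'v
    show "norm (x + \<Xi> s t - x) \<le> C * (t - s) powr \<alpha> * (1 + norm x)"
      using order_trans[OF assms(5)[OF st] weight] assms(2) by simp
  next
    fix s r t x assume srt: "0 \<le> s" "s < r" "r < t" "t \<le> T"
    show "norm (x + \<Xi> s r + \<Xi> r t - (x + \<Xi> s t)) \<le> C * (t - s) powr \<mu> * (1 + norm x)"
      using order_trans[OF assms(6)[OF srt] weight] assms(2) by (simp add: algebra_simps)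
  qed (use assms in auto)
  obtain u where "u 0 = 0" "small_order T \<mu> (\<lambda>s t. u t - (u s + \<Xi> s t))"
    using flow_exists by metis
  then show thesis by (intro that) (simp_all add: diff_diff_eq)
qed

section \<open>Orders of magnitude\<close>

lemma holder_pairs_iff:
  "holder_pairs T \<gamma> F \<longleftrightarrow> continuous_on (time_pairs T) (\<lambda>(s, t). F s t) \<and>
     (\<exists>M\<ge>0. \<forall>s t. 0 \<le> s \<longrightarrow> s < t \<longrightarrow> t \<le> T \<longrightarrow> norm (F s t) \<le> M * (t - s) powr \<gamma>)"
proof -
  have "bdd_above ((\<lambda>(s, t). norm (F s t) / (t - s) powr \<gamma>) ` time_pairs T) \<longleftrightarrow>
      (\<exists>M. \<forall>s t. 0 \<le> s \<longrightarrow> s < t \<longrightarrow> t \<le> T \<longrightarrow> norm (F s t) \<le> M * (t - s) powr \<gamma>)"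
    unfolding bdd_above_def ball_simps(9) by (intro ex_cong1) (auto simp: time_pairs_def pos_divide_le_eq)
  also have "\<dots> \<longleftrightarrow> (\<exists>M\<ge>0. \<forall>s t. 0 \<le> s \<longrightarrow> s < t \<longrightarrow> t \<le> T \<longrightarrow> norm (F s t) \<le> M * (t - s) powr \<gamma>)"
    (is "(\<exists>M. ?P M) \<longleftrightarrow> (\<exists>M\<ge>0. ?P M)")
  proof
    assume "\<exists>M. ?P M"
    then obtain M where M: "?P M" by blast
    have "?P (max 0 M)"
    proof (intro allI impI)
      fix s t :: real assume "0 \<le> s" "s < t" "t \<le> T"
      with M have "norm (F s t) \<le> M * (t - s) powr \<gamma>" by blast
      also have "\<dots> \<le> max 0 M * (t - s) powr \<gamma>" by (intro mult_right_mono) auto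
      finally show "norm (F s t) \<le> max 0 M * (t - s) powr \<gamma>" .
    qed
    then show "\<exists>M\<ge>0. ?P M" by (intro exI[of _ "max 0 M"]) simp
  qed blast
  finally show ?thesis by (simp add: holder_pairs_def)
qed

lemma holder_path_iff:
  "holder_path T \<gamma> f \<longleftrightarrow> continuous_on {0..T} f \<and>
     (\<exists>M\<ge>0. \<forall>s t. 0 \<le> s \<longrightarrow> s < t \<longrightarrow> t \<le> T \<longrightarrow> norm (f t - f s) \<le> M * (t - s) powr \<gamma>)"
proof (cases "continuous_on {0..T} f")
  case True
  have "continuous_on (time_pairs T) (\<lambda>z. f (snd z) - f (fst z))"
    by (intro continuous_on_diff continuous_on_compose2[OF True] continuous_on_snd continuous_on_fst
        continuous_on_id) (auto simp: time_pairs_def)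
  then have "holder_path T \<gamma> f \<longleftrightarrow> holder_pairs T \<gamma> (\<lambda>s t. f t - f s)"
    using True by (simp add: holder_path_def holder_pairs_def split_beta)
  with True \<open>continuous_on (time_pairs T) _\<close> show ?thesis by (simp add: holder_pairs_iff split_beta)
qed (simp add: holder_path_def)

lemma holder_path_bounded:
  assumes "holder_path T \<gamma> f"
  obtains M where "0 \<le> M" "\<And>t. 0 \<le> t \<Longrightarrow> t \<le> T \<Longrightarrow> norm (f t) \<le> M"
proof -
  have "compact (f ` {0..T})"
    using assms(1) by (intro compact_continuous_image) (auto simp: holder_path_def)
  then obtain M where M: "\<And>y. y \<in> f ` {0..T} \<Longrightarrow> norm y \<le> M"
    using compact_imp_bounded bounded_iff by meson
  then show thesis by (intro that[of "max 0 M"]) (auto simp: le_max_iff_disj)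
qed

text \<open>The scale \<open>h powr \<gamma> * w ^ k\<close>: \<open>h\<close> is the length of a time interval, \<open>w\<close> a weight that dominates
  the size of the state, and \<open>k\<close> counts how often the state enters.\<close>

locale scale =
  fixes S :: "'z set" and h w :: "'z \<Rightarrow> real" and T :: real
  assumes h_pos: "\<And>z. z \<in> S \<Longrightarrow> 0 < h z" and h_le: "\<And>z. z \<in> S \<Longrightarrow> h z \<le> T"
    and w_ge_1: "\<And>z. z \<in> S \<Longrightarrow> 1 \<le> w z"
begin

text \<open>A big-O relation, uniform over the sample set S. As a predicate closed under sums and
  products it lets long expansions be estimated term by term, with no constants to track.\<close>

definition ord :: "real \<Rightarrow> nat \<Rightarrow> ('z \<Rightarrow> 'v::real_normed_vector) \<Rightarrow> bool" where
  "ord \<gamma> k f \<longleftrightarrow> (\<exists>C\<ge>0. \<forall>z\<in>S. norm (f z) \<le> C * (h z powr \<gamma> * w z ^ k))"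

lemma scale_nonneg: "z \<in> S \<Longrightarrow> 0 \<le> h z powr \<gamma> * w z ^ k"
  using w_ge_1[of z] by simp

lemma ordI:
  assumes "0 \<le> C" "\<And>z. z \<in> S \<Longrightarrow> norm (f z) \<le> C * (h z powr \<gamma> * w z ^ k)"
  shows "ord \<gamma> k f"
  using assms by (auto simp: ord_def)

lemma ord_add:
  assumes "ord \<gamma> k f" "ord \<gamma> k g"
  shows "ord \<gamma> k (\<lambda>z. f z + g z)"
proof -
  obtain C where C: "0 \<le> C" "\<And>z. z \<in> S \<Longrightarrow> norm (f z) \<le> C * (h z powr \<gamma> * w z ^ k)"
    using assms(1) by (auto simp: ord_def)
  obtain D where D: "0 \<le> D" "\<And>z. z \<in> S \<Longrightarrow> norm (g z) \<le> D * (h z powr \<gamma> * w z ^ k)"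
    using assms(2) by (auto simp: ord_def)
  show ?thesis
    by (rule ordI[of "C + D"])
      (use C D in \<open>auto simp: distrib_right intro: norm_triangle_le add_mono\<close>)
qed

lemma ord_uminus: "ord \<gamma> k f \<Longrightarrow> ord \<gamma> k (\<lambda>z. - f z)"
  by (simp add: ord_def)

lemma ord_diff: "ord \<gamma> k f \<Longrightarrow> ord \<gamma> k g \<Longrightarrow> ord \<gamma> k (\<lambda>z. f z - g z)"
  using ord_add[of \<gamma> k f "\<lambda>z. - g z"] ord_uminus[of \<gamma> k g] by simp

lemma ord_zero: "ord \<gamma> k (\<lambda>z. 0)"
  by (rule ordI[of 0]) auto

lemma ord_sum: "finite A \<Longrightarrow> (\<And>i. i \<in> A \<Longrightarrow> ord \<gamma> k (f i)) \<Longrightarrow> ord \<gamma> k (\<lambda>z. \<Sum>i\<in>A. f i z)"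
  by (induction rule: finite_induct) (auto intro: ord_zero ord_add)

lemma ord_scaleR:
  assumes "ord \<delta> i f" "ord \<epsilon> j g" "\<delta> + \<epsilon> = \<gamma>" "i + j = k"
  shows "ord \<gamma> k (\<lambda>z. f z *\<^sub>R g z)"
proof -
  obtain C where C: "0 \<le> C" "\<And>z. z \<in> S \<Longrightarrow> norm (f z) \<le> C * (h z powr \<delta> * w z ^ i)"
    using assms(1) by (auto simp: ord_def)
  obtain D where D: "0 \<le> D" "\<And>z. z \<in> S \<Longrightarrow> norm (g z) \<le> D * (h z powr \<epsilon> * w z ^ j)"
    using assms(2) by (auto simp: ord_def)
  show ?thesis
  proof (rule ordI[of "C * D"])
    fix z assume z: "z \<in> S"
    have "norm (f z *\<^sub>R g z) \<le> (C * (h z powr \<delta> * w z ^ i)) * (D * (h z powr \<epsilon> * w z ^ j))"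
      unfolding norm_scaleR real_norm_def[symmetric] using C D scale_nonneg z by (intro mult_mono) auto
    also have "\<dots> = C * D * (h z powr \<gamma> * w z ^ k)"
      by (simp add: assms(3,4)[symmetric] powr_add power_add mult_ac)
    finally show "norm (f z *\<^sub>R g z) \<le> C * D * (h z powr \<gamma> * w z ^ k)" .
  qed (use C D in simp)
qed

text \<open>Lowering the exponent costs a power of T, since h is at most T; raising the power of w
  is free, since w is at least 1. This brings terms of different orders to a common one.\<close>

lemma ord_mono:
  assumes "ord \<delta> i f" "\<gamma> \<le> \<delta>" "i \<le> k"
  shows "ord \<gamma> k f"
proof -
  obtain C where C: "0 \<le> C" "\<And>z. z \<in> S \<Longrightarrow> norm (f z) \<le> C * (h z powr \<delta> * w z ^ i)"
    using assms(1) by (auto simp: ord_def)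
  show ?thesis
  proof (rule ordI[of "C * T powr (\<delta> - \<gamma>)"])
    fix z assume z: "z \<in> S"
    have "h z powr \<delta> \<le> T powr (\<delta> - \<gamma>) * h z powr \<gamma>"
      using h_pos[OF z] h_le[OF z] assms by (intro powr_le_lower_powr) auto
    then have "h z powr \<delta> * w z ^ i \<le> T powr (\<delta> - \<gamma>) * h z powr \<gamma> * w z ^ k"
      using w_ge_1[OF z] assms by (intro mult_mono power_increasing) auto
    then have "C * (h z powr \<delta> * w z ^ i) \<le> C * (T powr (\<delta> - \<gamma>) * h z powr \<gamma> * w z ^ k)"
      using C by (intro mult_left_mono)
    then show "norm (f z) \<le> C * T powr (\<delta> - \<gamma>) * (h z powr \<gamma> * w z ^ k)"
      using C(2)[OF z] by (simp add: mult.assoc)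
  qed (use C in simp)
qed

lemma ord_cong: "(\<And>z. z \<in> S \<Longrightarrow> f z = g z) \<Longrightarrow> ord \<gamma> k f \<longleftrightarrow> ord \<gamma> k g"
  by (auto simp: ord_def)

lemma ord_nth:
  fixes f :: "'z \<Rightarrow> 'v::real_normed_vector ^ 'n"
  assumes "ord \<gamma> k f"
  shows "ord \<gamma> k (\<lambda>z. f z $ i)"
proof -
  obtain C where C: "0 \<le> C" "\<And>z. z \<in> S \<Longrightarrow> norm (f z) \<le> C * (h z powr \<gamma> * w z ^ k)"
    using assms by (auto simp: ord_def)
  show ?thesis by (rule ordI[OF C(1) order_trans[OF Finite_Cartesian_Product.norm_nth_le C(2)]])
qed

lemma ord_holder_increment:
  assumes "holder_path T \<gamma> f" "0 \<le> \<gamma>"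
    and "\<And>z. z \<in> S \<Longrightarrow> 0 \<le> u z \<and> u z < v z \<and> v z \<le> T \<and> v z - u z \<le> h z"
  shows "ord \<gamma> 0 (\<lambda>z. f (v z) - f (u z))"
proof -
  obtain M where M: "0 \<le> M" "\<And>s t. 0 \<le> s \<Longrightarrow> s < t \<Longrightarrow> t \<le> T \<Longrightarrow> norm (f t - f s) \<le> M * (t - s) powr \<gamma>"
    using assms(1) unfolding holder_path_iff by blast
  show ?thesis
  proof (rule ordI[of M])
    fix z assume z: "z \<in> S"
    note uv = assms(3)[OF z]
    have "norm (f (v z) - f (u z)) \<le> M * (v z - u z) powr \<gamma>"
      using M(2)[of "u z" "v z"] uv by simp
    also have "\<dots> \<le> M * h z powr \<gamma>"
      using uv assms(2) M(1) by (intro mult_left_mono powr_mono2) auto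
    finally show "norm (f (v z) - f (u z)) \<le> M * (h z powr \<gamma> * w z ^ 0)" by simp
  qed (rule M(1))
qed

lemma ord_holder_pairs:
  assumes "holder_pairs T \<gamma> F" "0 \<le> \<gamma>"
    and "\<And>z. z \<in> S \<Longrightarrow> 0 \<le> u z \<and> u z < v z \<and> v z \<le> T \<and> v z - u z \<le> h z"
  shows "ord \<gamma> 0 (\<lambda>z. F (u z) (v z))"
proof -
  obtain M where M: "0 \<le> M" "\<And>s t. 0 \<le> s \<Longrightarrow> s < t \<Longrightarrow> t \<le> T \<Longrightarrow> norm (F s t) \<le> M * (t - s) powr \<gamma>"
    using assms(1) unfolding holder_pairs_iff by blast
  show ?thesis
  proof (rule ordI[of M])
    fix z assume z: "z \<in> S"
    note uv = assms(3)[OF z]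
    have "norm (F (u z) (v z)) \<le> M * (v z - u z) powr \<gamma>"
      using M(2)[of "u z" "v z"] uv by simp
    also have "\<dots> \<le> M * h z powr \<gamma>"
      using uv assms(2) M(1) by (intro mult_left_mono powr_mono2) auto
    finally show "norm (F (u z) (v z)) \<le> M * (h z powr \<gamma> * w z ^ 0)" by simp
  qed (rule M(1))
qed

lemma ord_holder_bounded:
  assumes "holder_path T \<gamma> f" and "\<And>z. z \<in> S \<Longrightarrow> 0 \<le> u z \<and> u z \<le> T"
  shows "ord 0 0 (\<lambda>z. f (u z))"
proof -
  obtain M where M: "0 \<le> M" "\<And>t. 0 \<le> t \<Longrightarrow> t \<le> T \<Longrightarrow> norm (f t) \<le> M"
    using holder_path_bounded[OF assms(1)] by metis
  show ?thesis
  proof (rule ordI[OF M(1)])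
    fix z assume z: "z \<in> S"
    then show "norm (f (u z)) \<le> M * (h z powr 0 * w z ^ 0)"
      using M(2)[of "u z"] assms(2)[OF z] h_pos[OF z] by simp
  qed
qed

end

section \<open>The one-step scheme of the equation\<close>

text \<open>Chen's relation from 0 through s to t creates cross terms of the increments over the two
  pieces, and expanding the square creates the same ones, so they cancel. What remains is local in
  the pair, which shows that the bracket is 2\<alpha>-Hoelder. At s = 0 the bracket has its
  prescribed value instead.\<close>

lemma bracket_increment:
  assumes rp: "rough_path0 T \<alpha> \<omega> W" and st: "0 \<le> s" "s < t" "t \<le> T"
  shows "(bracket \<omega> W t - bracket \<omega> W s) $ p $ q =
    (\<omega> t - \<omega> s) $ p * (\<omega> t - \<omega> s) $ q - W s t $ p $ q - W s t $ q $ p"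
proof (cases "s = 0")
  case True
  then show ?thesis using st by (simp add: bracket_def outer_def transpose_def)
next
  case False
  then have "W 0 t - W 0 s - W s t = outer (\<omega> s - \<omega> 0) (\<omega> t - \<omega> s)"
    using rp st by (simp add: rough_path0_def)
  then have "W 0 t $ i $ j = W 0 s $ i $ j + W s t $ i $ j + (\<omega> s - \<omega> 0) $ i * (\<omega> t - \<omega> s) $ j" for i j
    by (simp add: vec_eq_iff outer_def algebra_simps)
  from this[of p q] this[of q p] show ?thesis using False st
    by (simp add: bracket_def outer_def transpose_def algebra_simps)
qed

locale rde_data =
  fixes T \<alpha> \<beta> :: real
    and \<omega> :: "real \<Rightarrow> real^'d" and W :: "real \<Rightarrow> real \<Rightarrow> real^'d^'d"
    and a :: "real \<Rightarrow> (real^'e)^'e^'d" and a' :: "real \<Rightarrow> ((real^'e)^'e^'d)^'d"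
    and b :: "real \<Rightarrow> (real^'e)^'d" and b' :: "real \<Rightarrow> ((real^'e)^'d)^'d"
    and \<Lambda> :: "real \<Rightarrow> (real^'e)^'e^'d^'d" and l :: "real \<Rightarrow> (real^'e)^'d^'d"
  assumes T_pos: "T > 0" and \<alpha>_pos: "0 < \<alpha>" and \<beta>_pos: "0 < \<beta>" and \<beta>_le: "\<beta> \<le> \<alpha>" and
    \<mu>_gt_1: "1 < 2 * \<alpha> + \<beta>"
    and rp: "rough_path0 T \<alpha> \<omega> W"
    and a_ctrl: "controlled1 T \<alpha> \<beta> \<omega> a a'"
    and b_ctrl: "controlled1 T \<alpha> \<beta> \<omega> b b'"
    and \<Lambda>_holder: "holder_path T \<beta> \<Lambda>"
    and l_holder: "holder_path T \<beta> l"
begin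

definition c :: "real \<Rightarrow> real^'e \<Rightarrow> (real^'e)^'d" where
  "c t x = tensor1 (a t) x + b t"

text \<open>The derivative of the state is replaced by its prescribed value \<open>c t x\<close>;
  this makes the derivative of the integrand an affine function of the state alone.\<close>

definition c' :: "real \<Rightarrow> real^'e \<Rightarrow> ((real^'e)^'d)^'d" where
  "c' t x = integrand_deriv (a t) (a' t) (b' t) x (c t x)"

definition g :: "real \<Rightarrow> real^'e \<Rightarrow> (real^'e)^'d^'d" where
  "g t x = tensor2 (\<Lambda> t) x + l t"

definition rough_germ :: "real \<Rightarrow> real \<Rightarrow> real^'e \<Rightarrow> real^'e" where
  "rough_germ s t x = (\<Sum>i\<in>UNIV. (\<omega> t - \<omega> s) $ i *\<^sub>R c s x $ i) +
     (\<Sum>i\<in>UNIV. \<Sum>j\<in>UNIV. W s t $ j $ i *\<^sub>R c' s x $ j $ i)"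

text \<open>The entries are kept apart because the bracket integral asks for a Young integral of
  each entry, and each must be sewn on its own.\<close>

definition bracket_germ :: "'d \<Rightarrow> 'd \<Rightarrow> real \<Rightarrow> real \<Rightarrow> real^'e \<Rightarrow> real^'e" where
  "bracket_germ p q s t x = (bracket \<omega> W t $ p $ q - bracket \<omega> W s $ p $ q) *\<^sub>R g s x $ p $ q"

definition step :: "real \<Rightarrow> real \<Rightarrow> real^'e \<Rightarrow> real^'e" where
  "step s t x = x + rough_germ s t x + (\<Sum>p\<in>UNIV. \<Sum>q\<in>UNIV. bracket_germ p q s t x)"

lemma c_nth: "c t x $ p = (\<Sum>k\<in>UNIV. x $ k *\<^sub>R a t $ p $ k) + b t $ p"
  by (simp add: c_def tensor1_def)

lemma c'_nth: "c' t x $ j $ p =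
    (\<Sum>k\<in>UNIV. x $ k *\<^sub>R a' t $ j $ p $ k + c t x $ j $ k *\<^sub>R a t $ p $ k) + b' t $ j $ p"
  by (simp add: c'_def integrand_deriv_def)

lemma g_nth: "g t x $ p $ q = (\<Sum>k\<in>UNIV. x $ k *\<^sub>R \<Lambda> t $ p $ q $ k) + l t $ p $ q"
  by (simp add: g_def tensor2_def)

end

text \<open>Three kinds of samples pass through these estimates: two times with a state, three times
  with a state, and three times along a given path. The abstract index makes every estimate uniform
  in all of them; w dominates the state.\<close>

locale rde_sample = rde_data T \<alpha> \<beta> \<omega> W a a' b b' \<Lambda> l
  for T \<alpha> \<beta> and \<omega> :: "real \<Rightarrow> real^'d" and W
    and a :: "real \<Rightarrow> (real^'e)^'e^'d" and a' b b' \<Lambda> l +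
  fixes S :: "'z set" and s r t w :: "'z \<Rightarrow> real" and x :: "'z \<Rightarrow> real^'e"
  assumes times: "\<And>z. z \<in> S \<Longrightarrow> 0 \<le> s z \<and> s z < r z \<and> r z < t z \<and> t z \<le> T"
    and w_ge_1: "\<And>z. z \<in> S \<Longrightarrow> 1 \<le> w z" and x_le_w: "\<And>z. z \<in> S \<Longrightarrow> norm (x z) \<le> w z"
begin

sublocale scale S "\<lambda>z. t z - s z" w T
proof
  fix z assume "z \<in> S"
  from times[OF this] w_ge_1[OF this] show "0 < t z - s z" "t z - s z \<le> T" "1 \<le> w z" by auto
qed

lemmas a_holder = a_ctrl[unfolded controlled1_def, THEN conjunct1]
  and a'_holder = a_ctrl[unfolded controlled1_def, THEN conjunct2, THEN conjunct1]
  and a_rem = a_ctrl[unfolded controlled1_def, THEN conjunct2, THEN conjunct2]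
  and b_holder = b_ctrl[unfolded controlled1_def, THEN conjunct1]
  and b'_holder = b_ctrl[unfolded controlled1_def, THEN conjunct2, THEN conjunct1]
  and b_rem = b_ctrl[unfolded controlled1_def, THEN conjunct2, THEN conjunct2]
  and \<omega>_holder = rp[unfolded rough_path0_def, THEN conjunct1]
  and W_holder = rp[unfolded rough_path0_def, THEN conjunct2, THEN conjunct1]

lemma time_bounds:
  assumes "z \<in> S"
  shows "0 \<le> s z \<and> s z \<le> T" "0 \<le> r z \<and> r z \<le> T"
    "0 \<le> s z \<and> s z < r z \<and> r z \<le> T \<and> r z - s z \<le> t z - s z"
  using times[OF assms] by auto

lemma ord_x: "ord 0 1 x"
proof (rule ordI)
  fix z assume "z \<in> S"
  then show "norm (x z) \<le> 1 * ((t z - s z) powr 0 * w z ^ 1)"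
    using x_le_w[of z] times[of z] by simp
qed simp

lemma ord_at_s: "holder_path T \<gamma> f \<Longrightarrow> ord 0 0 (\<lambda>z. f (s z))"
  by (rule ord_holder_bounded[OF _ time_bounds(1)])

lemma ord_at_r: "holder_path T \<gamma> f \<Longrightarrow> ord 0 0 (\<lambda>z. f (r z))"
  by (rule ord_holder_bounded[OF _ time_bounds(2)])

lemma ord_increment: "holder_path T \<beta> f \<Longrightarrow> ord \<beta> 0 (\<lambda>z. f (r z) - f (s z))"
  using \<beta>_pos by (intro ord_holder_increment[OF _ _ time_bounds(3)]) simp_all

lemmas ord_coeff =
  ord_at_s[OF a_holder] ord_at_s[OF a'_holder] ord_at_s[OF b_holder]
  ord_at_s[OF b'_holder] ord_at_s[OF \<Lambda>_holder] ord_at_s[OF l_holder]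
  ord_at_r[OF a_holder] ord_at_r[OF a'_holder] ord_at_r[OF \<Lambda>_holder]

lemmas ord_coeff_increment =
  ord_increment[OF a_holder] ord_increment[OF a'_holder] ord_increment[OF b'_holder]
  ord_increment[OF \<Lambda>_holder] ord_increment[OF l_holder]

lemma ord_driver:
  assumes "\<And>z. z \<in> S \<Longrightarrow> s z \<le> u z \<and> u z < v z \<and> v z \<le> t z"
  shows "ord \<alpha> 0 (\<lambda>z. \<omega> (v z) - \<omega> (u z))" "ord (2 * \<alpha>) 0 (\<lambda>z. W (u z) (v z))"
    "ord (2 * \<alpha>) 0 (\<lambda>z. bracket \<omega> W (v z) $ p $ q - bracket \<omega> W (u z) $ p $ q)"
proof -
  have uv: "0 \<le> u z \<and> u z < v z \<and> v z \<le> T \<and> v z - u z \<le> t z - s z" if "z \<in> S" for z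
    using assms[OF that] times[OF that] by auto
  show w: "ord \<alpha> 0 (\<lambda>z. \<omega> (v z) - \<omega> (u z))"
    by (rule ord_holder_increment[OF \<omega>_holder _ uv]) (use \<alpha>_pos in simp_all)
  show W: "ord (2 * \<alpha>) 0 (\<lambda>z. W (u z) (v z))"
    by (rule ord_holder_pairs[OF W_holder _ uv]) (use \<alpha>_pos in simp_all)
  have "ord (2 * \<alpha>) 0 (\<lambda>z. (\<omega> (v z) - \<omega> (u z)) $ p *\<^sub>R (\<omega> (v z) - \<omega> (u z)) $ q)"
    by (rule ord_scaleR[OF ord_nth[OF w] ord_nth[OF w]]) simp_all
  from ord_diff[OF ord_diff[OF this ord_nth[OF ord_nth[OF W]]] ord_nth[OF ord_nth[OF W]]]
  have "ord (2 * \<alpha>) 0 (\<lambda>z. (\<omega> (v z) - \<omega> (u z)) $ p *\<^sub>R (\<omega> (v z) - \<omega> (u z)) $ q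
      - W (u z) (v z) $ p $ q - W (u z) (v z) $ q $ p)" .
  then show "ord (2 * \<alpha>) 0 (\<lambda>z. bracket \<omega> W (v z) $ p $ q - bracket \<omega> W (u z) $ p $ q)"
  proof (rule ord_cong[THEN iffD1, rotated])
    fix z assume "z \<in> S"
    with bracket_increment[OF rp, of "u z" "v z" p q] uv[of z]
    show "(\<omega> (v z) - \<omega> (u z)) $ p *\<^sub>R (\<omega> (v z) - \<omega> (u z)) $ q - W (u z) (v z) $ p $ q - W (u z) (v z) $ q $ p
        = bracket \<omega> W (v z) $ p $ q - bracket \<omega> W (u z) $ p $ q" by simp
  qed
qed

lemma ord_c: "ord 0 1 (\<lambda>z. c (s z) (x z) $ p)"
proof -
  have "ord 0 1 (\<lambda>z. x z $ k *\<^sub>R a (s z) $ p $ k)" for k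
    by (rule ord_scaleR[OF ord_nth[OF ord_x] ord_nth[OF ord_nth[OF ord_coeff(1)]]]) simp_all
  moreover have "ord 0 1 (\<lambda>z. b (s z) $ p)"
    by (rule ord_mono[OF ord_nth[OF ord_coeff(3)]]) simp_all
  ultimately show ?thesis unfolding c_nth by (intro ord_add ord_sum finite)
qed

lemma ord_c': "ord 0 1 (\<lambda>z. c' (s z) (x z) $ j $ p)"
proof -
  have "ord 0 1 (\<lambda>z. x z $ k *\<^sub>R a' (s z) $ j $ p $ k)" for k
    by (rule ord_scaleR[OF ord_nth[OF ord_x] ord_nth[OF ord_nth[OF ord_nth[OF ord_coeff(2)]]]]) simp_all
  moreover have "ord 0 1 (\<lambda>z. c (s z) (x z) $ j $ k *\<^sub>R a (s z) $ p $ k)" for k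
    by (rule ord_scaleR[OF ord_nth[OF ord_c] ord_nth[OF ord_nth[OF ord_coeff(1)]]]) simp_all
  moreover have "ord 0 1 (\<lambda>z. b' (s z) $ j $ p)"
    by (rule ord_mono[OF ord_nth[OF ord_nth[OF ord_coeff(4)]]]) simp_all
  ultimately show ?thesis unfolding c'_nth by (intro ord_add ord_sum finite)
qed

lemma ord_g: "ord 0 1 (\<lambda>z. g (s z) (x z) $ p $ q)"
proof -
  have "ord 0 1 (\<lambda>z. x z $ k *\<^sub>R \<Lambda> (s z) $ p $ q $ k)" for k
    by (rule ord_scaleR[OF ord_nth[OF ord_x] ord_nth[OF ord_nth[OF ord_nth[OF ord_coeff(5)]]]]) simp_all
  moreover have "ord 0 1 (\<lambda>z. l (s z) $ p $ q)"
    by (rule ord_mono[OF ord_nth[OF ord_nth[OF ord_coeff(6)]]]) simp_all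
  ultimately show ?thesis unfolding g_nth by (intro ord_add ord_sum finite)
qed

text \<open>Without its first-level term a germ has order 2\<alpha>; this is the remainder that
  makes the one-step image look controlled.\<close>

lemma ord_germs:
  assumes "\<And>z. z \<in> S \<Longrightarrow> s z < v z \<and> v z \<le> t z"
  shows "ord \<alpha> 1 (\<lambda>z. rough_germ (s z) (v z) (x z))"
    and "ord (2 * \<alpha>) 1 (\<lambda>z. rough_germ (s z) (v z) (x z) - (\<Sum>i\<in>UNIV. (\<omega> (v z) - \<omega> (s z)) $ i *\<^sub>R c (s z) (x z) $ i))"
    and "ord (2 * \<alpha>) 1 (\<lambda>z. bracket_germ p q (s z) (v z) (x z))"
proof -
  have sv: "\<And>z. z \<in> S \<Longrightarrow> s z \<le> s z \<and> s z < v z \<and> v z \<le> t z" using assms by simp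
  note drv = ord_driver[of s v, OF sv]
  have w: "ord \<alpha> 1 (\<lambda>z. \<Sum>i\<in>UNIV. (\<omega> (v z) - \<omega> (s z)) $ i *\<^sub>R c (s z) (x z) $ i)"
    by (intro ord_sum finite ord_scaleR[OF ord_nth[OF drv(1)] ord_c]) simp_all
  have W: "ord (2 * \<alpha>) 1 (\<lambda>z. \<Sum>i\<in>UNIV. \<Sum>j\<in>UNIV. W (s z) (v z) $ j $ i *\<^sub>R c' (s z) (x z) $ j $ i)"
    by (intro ord_sum finite ord_scaleR[OF ord_nth[OF ord_nth[OF drv(2)]] ord_c']) simp_all
  show "ord \<alpha> 1 (\<lambda>z. rough_germ (s z) (v z) (x z))"
    unfolding rough_germ_def by (intro ord_add w ord_mono[OF W]) (use \<alpha>_pos in simp_all)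
  show "ord (2 * \<alpha>) 1 (\<lambda>z. rough_germ (s z) (v z) (x z) - (\<Sum>i\<in>UNIV. (\<omega> (v z) - \<omega> (s z)) $ i *\<^sub>R c (s z) (x z) $ i))"
    unfolding rough_germ_def using W by simp
  show "ord (2 * \<alpha>) 1 (\<lambda>z. bracket_germ p q (s z) (v z) (x z))"
    unfolding bracket_germ_def by (rule ord_scaleR[OF drv(3) ord_g]) simp_all
qed

end

text \<open>The Leibniz expansion behind the choice of \<^const>\<open>integrand_deriv\<close> as Gubinelli derivative, with
  \<open>u\<close> an increment of the driving path.\<close>

lemma product_taylor_identity:
  fixes A a :: "(real^'e)^'e^'d" and B b :: "(real^'e)^'d" and u :: "real^'d"
  shows "(tensor1 A y + B) $ p - (tensor1 a x + b) $ p - (\<Sum>j\<in>UNIV. u $ j *\<^sub>R integrand_deriv a a' b' x c $ j $ p) =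
    (\<Sum>k\<in>UNIV. x $ k *\<^sub>R (A - a - (\<Sum>j\<in>UNIV. u $ j *\<^sub>R a' $ j)) $ p $ k
        + (y - x - (\<Sum>j\<in>UNIV. u $ j *\<^sub>R c $ j)) $ k *\<^sub>R a $ p $ k
        + (y - x) $ k *\<^sub>R (A - a) $ p $ k)
     + (B - b - (\<Sum>j\<in>UNIV. u $ j *\<^sub>R b' $ j)) $ p"
proof -
  have "(\<Sum>j\<in>UNIV. u $ j *\<^sub>R integrand_deriv a a' b' x c $ j $ p) =
      (\<Sum>j\<in>UNIV. \<Sum>k\<in>UNIV. u $ j *\<^sub>R (x $ k *\<^sub>R a' $ j $ p $ k + c $ j $ k *\<^sub>R a $ p $ k))
      + (\<Sum>j\<in>UNIV. u $ j *\<^sub>R b' $ j $ p)"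
    by (simp add: integrand_deriv_def scaleR_add_right scaleR_sum_right sum.distrib)
  also have "(\<Sum>j\<in>UNIV. \<Sum>k\<in>UNIV. u $ j *\<^sub>R (x $ k *\<^sub>R a' $ j $ p $ k + c $ j $ k *\<^sub>R a $ p $ k)) =
      (\<Sum>k\<in>UNIV. \<Sum>j\<in>UNIV. u $ j *\<^sub>R (x $ k *\<^sub>R a' $ j $ p $ k + c $ j $ k *\<^sub>R a $ p $ k))"
    by (rule sum.swap)
  also have "\<dots> = (\<Sum>k\<in>UNIV. x $ k *\<^sub>R (\<Sum>j\<in>UNIV. u $ j *\<^sub>R a' $ j $ p $ k)
      + (\<Sum>j\<in>UNIV. u $ j * c $ j $ k) *\<^sub>R a $ p $ k)"
    by (intro sum.cong refl)
      (simp add: scaleR_add_right sum.distrib scaleR_sum_right scaleR_sum_left mult.commute)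
  finally have eq: "(\<Sum>j\<in>UNIV. u $ j *\<^sub>R integrand_deriv a a' b' x c $ j $ p) = \<dots>
      + (\<Sum>j\<in>UNIV. u $ j *\<^sub>R b' $ j $ p)" .
  have "(\<Sum>k\<in>UNIV. x $ k *\<^sub>R (A - a - (\<Sum>j\<in>UNIV. u $ j *\<^sub>R a' $ j)) $ p $ k
        + (y - x - (\<Sum>j\<in>UNIV. u $ j *\<^sub>R c $ j)) $ k *\<^sub>R a $ p $ k
        + (y - x) $ k *\<^sub>R (A - a) $ p $ k)
    = (\<Sum>k\<in>UNIV. y $ k *\<^sub>R A $ p $ k - x $ k *\<^sub>R a $ p $ k - (x $ k *\<^sub>R (\<Sum>j\<in>UNIV. u $ j *\<^sub>R a' $ j $ p $ k)
      + (\<Sum>j\<in>UNIV. u $ j * c $ j $ k) *\<^sub>R a $ p $ k))"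
    by (intro sum.cong refl) (simp add: sum_component algebra_simps)
  then show ?thesis unfolding eq
    by (simp add: tensor1_def sum_subtractf sum_component)
qed

text \<open>y is the state reached at time r, either the one-step image of x or the value of a
  controlled path. A first-order remainder of order \<alpha> + \<beta> is all that the two cases
  have to share.\<close>

locale rde_sample_step = rde_sample T \<alpha> \<beta> \<omega> W a a' b b' \<Lambda> l S s r t w x
  for T \<alpha> \<beta> and \<omega> :: "real \<Rightarrow> real^'d" and W
    and a :: "real \<Rightarrow> (real^'e)^'e^'d" and a' b b' \<Lambda> l
    and S :: "'z set" and s r t w x +
  fixes y :: "'z \<Rightarrow> real^'e"
  assumes y_rem: "ord (\<alpha> + \<beta>) 1
    (\<lambda>z. y z - x z - (\<Sum>i\<in>UNIV. (\<omega> (r z) - \<omega> (s z)) $ i *\<^sub>R c (s z) (x z) $ i))"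
begin

lemma ord_\<omega>_sr: "ord \<alpha> 0 (\<lambda>z. \<omega> (r z) - \<omega> (s z))"
  and ord_\<omega>_rt: "ord \<alpha> 0 (\<lambda>z. \<omega> (t z) - \<omega> (r z))"
  and ord_W_rt: "ord (2 * \<alpha>) 0 (\<lambda>z. W (r z) (t z))"
  and ord_bracket_rt: "ord (2 * \<alpha>) 0 (\<lambda>z. bracket \<omega> W (t z) $ p $ q - bracket \<omega> W (r z) $ p $ q)"
  using times by (intro ord_driver; fastforce)+

lemma ord_y_increment: "ord \<alpha> 1 (\<lambda>z. y z - x z)"
proof -
  have "ord \<alpha> 1 (\<lambda>z. \<Sum>i\<in>UNIV. (\<omega> (r z) - \<omega> (s z)) $ i *\<^sub>R c (s z) (x z) $ i)"
    by (intro ord_sum finite ord_scaleR[OF ord_nth[OF ord_\<omega>_sr] ord_c]) simp_all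
  from ord_add[OF ord_mono[OF y_rem, of \<alpha> 1] this] \<beta>_pos show ?thesis by simp
qed

text \<open>In the Leibniz expansion each term is a bounded factor times a remainder of a, b or y,
  or else the product of an increment of y (order \<alpha>) and one of a (order \<beta>).\<close>

lemma ord_c_taylor: "ord (\<alpha> + \<beta>) 1 (\<lambda>z. c (r z) (y z) $ p - c (s z) (x z) $ p
    - (\<Sum>j\<in>UNIV. (\<omega> (r z) - \<omega> (s z)) $ j *\<^sub>R c' (s z) (x z) $ j $ p))"
proof -
  have \<alpha>\<beta>: "0 \<le> \<alpha> + \<beta>" using \<alpha>_pos \<beta>_pos by simp
  have "ord (\<alpha> + \<beta>) 1 (\<lambda>z. x z $ k *\<^sub>R (a (r z) - a (s z)
      - (\<Sum>j\<in>UNIV. (\<omega> (r z) - \<omega> (s z)) $ j *\<^sub>R a' (s z) $ j)) $ p $ k)" for k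
    by (rule ord_scaleR[OF ord_nth[OF ord_x]
          ord_nth[OF ord_nth[OF ord_holder_pairs[OF a_rem \<alpha>\<beta> time_bounds(3)]]]]) simp_all
  moreover have "ord (\<alpha> + \<beta>) 1 (\<lambda>z. (y z - x z
      - (\<Sum>j\<in>UNIV. (\<omega> (r z) - \<omega> (s z)) $ j *\<^sub>R c (s z) (x z) $ j)) $ k *\<^sub>R a (s z) $ p $ k)" for k
    by (rule ord_scaleR[OF ord_nth[OF y_rem] ord_nth[OF ord_nth[OF ord_coeff(1)]]]) simp_all
  moreover have "ord (\<alpha> + \<beta>) 1 (\<lambda>z. (y z - x z) $ k *\<^sub>R (a (r z) - a (s z)) $ p $ k)" for k
    by (rule ord_scaleR[OF ord_nth[OF ord_y_increment] ord_nth[OF ord_nth[OF ord_coeff_increment(1)]]]) simp_all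
  moreover have "ord (\<alpha> + \<beta>) 1 (\<lambda>z. (b (r z) - b (s z)
      - (\<Sum>j\<in>UNIV. (\<omega> (r z) - \<omega> (s z)) $ j *\<^sub>R b' (s z) $ j)) $ p)"
    by (rule ord_mono[OF ord_nth[OF ord_holder_pairs[OF b_rem \<alpha>\<beta> time_bounds(3)]]]) simp_all
  ultimately show ?thesis
    unfolding c_def c'_def product_taylor_identity by (intro ord_add ord_sum finite)
qed

lemma ord_c_increment: "ord \<beta> 1 (\<lambda>z. c (r z) (y z) $ p - c (s z) (x z) $ p)"
proof -
  have "ord \<alpha> 1 (\<lambda>z. \<Sum>j\<in>UNIV. (\<omega> (r z) - \<omega> (s z)) $ j *\<^sub>R c' (s z) (x z) $ j $ p)"
    by (intro ord_sum finite ord_scaleR[OF ord_nth[OF ord_\<omega>_sr] ord_c']) simp_all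
  from ord_add[OF ord_mono[OF ord_c_taylor, of \<beta> 1] ord_mono[OF this, of \<beta> 1], of p] \<alpha>_pos \<beta>_le
  show ?thesis by simp
qed

lemma ord_product_increment:
  assumes "ord \<beta> 1 (\<lambda>z. f z - f' z)" "ord 0 1 f'" "ord 0 0 F" "ord \<beta> 0 (\<lambda>z. F z - F' z)"
  shows "ord \<beta> 1 (\<lambda>z. f z *\<^sub>R F z - f' z *\<^sub>R F' z)"
proof -
  have "ord \<beta> 1 (\<lambda>z. (f z - f' z) *\<^sub>R F z + f' z *\<^sub>R (F z - F' z))"
    by (intro ord_add ord_scaleR[OF assms(1,3)] ord_scaleR[OF assms(2,4)]) simp_all
  then show ?thesis by (simp add: algebra_simps)
qed

lemma ord_state_product_increment:
  assumes "ord 0 0 F" "ord \<beta> 0 (\<lambda>z. F z - F' z)"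
  shows "ord \<beta> 1 (\<lambda>z. y z $ k *\<^sub>R F z - x z $ k *\<^sub>R F' z)"
  using ord_nth[OF ord_mono[OF ord_y_increment, of \<beta> 1], of k] \<beta>_le
  by (intro ord_product_increment ord_nth[OF ord_x] assms) simp

lemma ord_c'_increment: "ord \<beta> 1 (\<lambda>z. c' (r z) (y z) $ j $ p - c' (s z) (x z) $ j $ p)"
proof -
  have "ord \<beta> 1 (\<lambda>z. y z $ k *\<^sub>R a' (r z) $ j $ p $ k - x z $ k *\<^sub>R a' (s z) $ j $ p $ k)" for k
    using ord_nth[OF ord_nth[OF ord_nth[OF ord_coeff_increment(2)]], of j p k]
    by (intro ord_state_product_increment ord_nth[OF ord_nth[OF ord_nth[OF ord_coeff(8)]]]) simp
  moreover have "ord \<beta> 1 (\<lambda>z. c (r z) (y z) $ j $ k *\<^sub>R a (r z) $ p $ k - c (s z) (x z) $ j $ k *\<^sub>R a (s z) $ p $ k)" for k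
    using ord_nth[OF ord_nth[OF ord_coeff_increment(1)], of p k] ord_nth[OF ord_c_increment, of j k]
    by (intro ord_product_increment ord_nth[OF ord_c] ord_nth[OF ord_nth[OF ord_coeff(7)]]) simp_all
  moreover have "ord \<beta> 1 (\<lambda>z. b' (r z) $ j $ p - b' (s z) $ j $ p)"
    using ord_mono[OF ord_nth[OF ord_nth[OF ord_coeff_increment(3)]], of \<beta> 1] by simp
  ultimately have "ord \<beta> 1 (\<lambda>z. (\<Sum>k\<in>UNIV. (y z $ k *\<^sub>R a' (r z) $ j $ p $ k - x z $ k *\<^sub>R a' (s z) $ j $ p $ k)
      + (c (r z) (y z) $ j $ k *\<^sub>R a (r z) $ p $ k - c (s z) (x z) $ j $ k *\<^sub>R a (s z) $ p $ k))
      + (b' (r z) $ j $ p - b' (s z) $ j $ p))"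
    by (intro ord_add ord_sum finite)
  then show ?thesis
    by (rule ord_cong[THEN iffD1, rotated]) (simp add: c'_nth sum.distrib sum_subtractf)
qed

lemma ord_g_increment: "ord \<beta> 1 (\<lambda>z. g (r z) (y z) $ p $ q - g (s z) (x z) $ p $ q)"
proof -
  have "ord \<beta> 1 (\<lambda>z. y z $ k *\<^sub>R \<Lambda> (r z) $ p $ q $ k - x z $ k *\<^sub>R \<Lambda> (s z) $ p $ q $ k)" for k
    using ord_nth[OF ord_nth[OF ord_nth[OF ord_coeff_increment(4)]], of p q k]
    by (intro ord_state_product_increment ord_nth[OF ord_nth[OF ord_nth[OF ord_coeff(9)]]]) simp
  moreover have "ord \<beta> 1 (\<lambda>z. l (r z) $ p $ q - l (s z) $ p $ q)"
    using ord_mono[OF ord_nth[OF ord_nth[OF ord_coeff_increment(5)]], of \<beta> 1] by simp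
  ultimately have "ord \<beta> 1 (\<lambda>z. (\<Sum>k\<in>UNIV. y z $ k *\<^sub>R \<Lambda> (r z) $ p $ q $ k - x z $ k *\<^sub>R \<Lambda> (s z) $ p $ q $ k)
      + (l (r z) $ p $ q - l (s z) $ p $ q))"
    by (intro ord_add ord_sum finite)
  then show ?thesis
    by (rule ord_cong[THEN iffD1, rotated]) (simp add: g_nth sum_subtractf)
qed

text \<open>Increments of the bracket add up exactly, so only the change of the coefficient between
  s and r contributes, multiplied by the increment over the second piece.\<close>

lemma ord_bracket_defect: "ord (2 * \<alpha> + \<beta>) 1
    (\<lambda>z. bracket_germ p q (s z) (r z) (x z) + bracket_germ p q (r z) (t z) (y z) - bracket_germ p q (s z) (t z) (x z))"
proof -
  have "ord (2 * \<alpha> + \<beta>) 1 (\<lambda>z. (bracket \<omega> W (t z) $ p $ q - bracket \<omega> W (r z) $ p $ q) *\<^sub>R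
      (g (r z) (y z) $ p $ q - g (s z) (x z) $ p $ q))"
    by (rule ord_scaleR[OF ord_bracket_rt ord_g_increment]) simp_all
  then show ?thesis
    by (rule ord_cong[THEN iffD1, rotated]) (simp add: bracket_germ_def algebra_simps)
qed

text \<open>The cross term in Chen's relation is exactly the linear part of the change of c,
  multiplied by the second increment of \<omega>. It turns this change into its Taylor remainder;
  the second level over the later piece meets only the increment of c'.\<close>

lemma ord_rough_defect: "ord (2 * \<alpha> + \<beta>) 1
    (\<lambda>z. rough_germ (s z) (r z) (x z) + rough_germ (r z) (t z) (y z) - rough_germ (s z) (t z) (x z))"
proof -
  have "ord (2 * \<alpha> + \<beta>) 1 (\<lambda>z. \<Sum>i\<in>UNIV. (\<omega> (t z) - \<omega> (r z)) $ i *\<^sub>R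
      (c (r z) (y z) $ i - c (s z) (x z) $ i - (\<Sum>j\<in>UNIV. (\<omega> (r z) - \<omega> (s z)) $ j *\<^sub>R c' (s z) (x z) $ j $ i)))"
    by (intro ord_sum finite ord_scaleR[OF ord_nth[OF ord_\<omega>_rt] ord_c_taylor]) simp_all
  moreover have "ord (2 * \<alpha> + \<beta>) 1 (\<lambda>z. \<Sum>i\<in>UNIV. \<Sum>j\<in>UNIV. W (r z) (t z) $ j $ i *\<^sub>R
      (c' (r z) (y z) $ j $ i - c' (s z) (x z) $ j $ i))"
    by (intro ord_sum finite ord_scaleR[OF ord_nth[OF ord_nth[OF ord_W_rt]] ord_c'_increment]) simp_all
  ultimately have "ord (2 * \<alpha> + \<beta>) 1 (\<lambda>z. (\<Sum>i\<in>UNIV. (\<omega> (t z) - \<omega> (r z)) $ i *\<^sub>R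
      (c (r z) (y z) $ i - c (s z) (x z) $ i - (\<Sum>j\<in>UNIV. (\<omega> (r z) - \<omega> (s z)) $ j *\<^sub>R c' (s z) (x z) $ j $ i)))
      + (\<Sum>i\<in>UNIV. \<Sum>j\<in>UNIV. W (r z) (t z) $ j $ i *\<^sub>R (c' (r z) (y z) $ j $ i - c' (s z) (x z) $ j $ i)))"
    by (rule ord_add)
  then show ?thesis
  proof (rule ord_cong[THEN iffD1, rotated])
    fix z assume z: "z \<in> S"
    have "W (s z) (t z) - W (s z) (r z) - W (r z) (t z) = outer (\<omega> (r z) - \<omega> (s z)) (\<omega> (t z) - \<omega> (r z))"
      using rp times[OF z] unfolding rough_path0_def by blast
    then have chen: "W (s z) (t z) $ j $ i = W (s z) (r z) $ j $ i + W (r z) (t z) $ j $ i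
        + (\<omega> (r z) - \<omega> (s z)) $ j * (\<omega> (t z) - \<omega> (r z)) $ i" for i j
      by (drule_tac arg_cong[where f = "\<lambda>A. A $ j $ i"]) (simp add: outer_def algebra_simps)
    have st: "\<omega> (t z) - \<omega> (s z) = (\<omega> (r z) - \<omega> (s z)) + (\<omega> (t z) - \<omega> (r z))" by simp
    define u v where "u = \<omega> (r z) - \<omega> (s z)" and "v = \<omega> (t z) - \<omega> (r z)"
    show "(\<Sum>i\<in>UNIV. (\<omega> (t z) - \<omega> (r z)) $ i *\<^sub>R
      (c (r z) (y z) $ i - c (s z) (x z) $ i - (\<Sum>j\<in>UNIV. (\<omega> (r z) - \<omega> (s z)) $ j *\<^sub>R c' (s z) (x z) $ j $ i)))
      + (\<Sum>i\<in>UNIV. \<Sum>j\<in>UNIV. W (r z) (t z) $ j $ i *\<^sub>R (c' (r z) (y z) $ j $ i - c' (s z) (x z) $ j $ i))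
      = rough_germ (s z) (r z) (x z) + rough_germ (r z) (t z) (y z) - rough_germ (s z) (t z) (x z)"
      unfolding rough_germ_def chen st u_def[symmetric] v_def[symmetric]
      by (simp add: sum.distrib sum_subtractf scaleR_add_left scaleR_diff_left scaleR_diff_right
            scaleR_sum_right mult.commute)
  qed
qed

end

section \<open>Solutions as flow paths\<close>

definition affine_fun :: "('v::real_normed_vector \<Rightarrow> 'w::real_normed_vector) \<Rightarrow> bool" where
  "affine_fun F \<longleftrightarrow> linear (\<lambda>x. F x - F 0)"

lemma affine_fun_linear_comp:
  assumes "linear G" "affine_fun F"
  shows "affine_fun (\<lambda>x. G (F x))"
  using linear_compose[OF assms(2)[unfolded affine_fun_def] assms(1)]
  by (simp add: affine_fun_def o_def linear_diff[OF assms(1)])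

lemma affine_fun_const: "affine_fun (\<lambda>x. k)"
  by (simp add: affine_fun_def linear_iff)

lemma affine_fun_id: "affine_fun (\<lambda>x. x)"
  using linear_id by (simp add: affine_fun_def id_def)

lemma affine_fun_add: "affine_fun F \<Longrightarrow> affine_fun G \<Longrightarrow> affine_fun (\<lambda>x. F x + G x)"
  using linear_compose_add[of "\<lambda>x. F x - F 0" "\<lambda>x. G x - G 0"]
  by (simp add: affine_fun_def algebra_simps)

lemma affine_fun_sum: "finite A \<Longrightarrow> (\<And>i. i \<in> A \<Longrightarrow> affine_fun (F i)) \<Longrightarrow> affine_fun (\<lambda>x. \<Sum>i\<in>A. F i x)"
  by (induction rule: finite_induct) (auto intro: affine_fun_const affine_fun_add)

lemma affine_fun_nth:
  fixes F :: "'v::real_normed_vector \<Rightarrow> 'w::real_normed_vector ^ 'n"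
  shows "affine_fun F \<Longrightarrow> affine_fun (\<lambda>x. F x $ i)"
  by (rule affine_fun_linear_comp[where G = "\<lambda>v. v $ i"]) (simp add: linear_iff)

lemma affine_fun_scaleR_left: "affine_fun F \<Longrightarrow> affine_fun (\<lambda>x. F x *\<^sub>R v)"
  by (rule affine_fun_linear_comp[where G = "\<lambda>k. k *\<^sub>R v"]) (simp add: linear_iff scaleR_add_left)

lemma affine_fun_scaleR_right: "affine_fun F \<Longrightarrow> affine_fun (\<lambda>x. k *\<^sub>R F x)"
  by (rule affine_fun_linear_comp[where G = "\<lambda>v. k *\<^sub>R v"]) (simp add: linear_iff scaleR_add_right)

section \<open>Algebra of Hoelder paths\<close>

lemma holder_path_vec:
  fixes f :: "real \<Rightarrow> 'v::real_normed_vector ^ 'n"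
  assumes "\<And>i. holder_path T \<gamma> (\<lambda>t. f t $ i)"
  shows "holder_path T \<gamma> f"
proof -
  have "\<forall>i. \<exists>M\<ge>0. \<forall>s t. 0 \<le> s \<longrightarrow> s < t \<longrightarrow> t \<le> T \<longrightarrow> norm (f t $ i - f s $ i) \<le> M * (t - s) powr \<gamma>"
    using assms by (simp add: holder_path_iff)
  then obtain M where M: "\<And>i. 0 \<le> M i"
    "\<And>i s t. 0 \<le> s \<Longrightarrow> s < t \<Longrightarrow> t \<le> T \<Longrightarrow> norm (f t $ i - f s $ i) \<le> M i * (t - s) powr \<gamma>" by metis
  have "norm (f t - f s) \<le> (\<Sum>i\<in>UNIV. M i) * (t - s) powr \<gamma>" if "0 \<le> s" "s < t" "t \<le> T" for s t
  proof -
    have "norm (f t - f s) \<le> (\<Sum>i\<in>UNIV. norm ((f t - f s) $ i))"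
      unfolding norm_vec_def by (rule L2_set_le_sum) simp
    also have "\<dots> \<le> (\<Sum>i\<in>UNIV. M i) * (t - s) powr \<gamma>"
      unfolding sum_distrib_right using M(2)[OF that] by (intro sum_mono) simp
    finally show ?thesis .
  qed
  moreover have "continuous_on {0..T} f"
    using assms continuous_on_vec_lambda[of "{0..T}" "\<lambda>i t. f t $ i"] by (simp add: holder_path_iff)
  ultimately show ?thesis
    unfolding holder_path_iff using M(1) by (intro conjI exI[of _ "\<Sum>i\<in>UNIV. M i"]) (auto intro: sum_nonneg)
qed

lemma holder_path_nth:
  fixes f :: "real \<Rightarrow> 'v::real_normed_vector ^ 'n"
  assumes "holder_path T \<gamma> f"
  shows "holder_path T \<gamma> (\<lambda>t. f t $ i)"
proof -
  obtain M where M: "0 \<le> M" "\<And>s t. 0 \<le> s \<Longrightarrow> s < t \<Longrightarrow> t \<le> T \<Longrightarrow> norm (f t - f s) \<le> M * (t - s) powr \<gamma>"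
    using assms unfolding holder_path_iff by blast
  have "norm (f t $ i - f s $ i) \<le> M * (t - s) powr \<gamma>" if "0 \<le> s" "s < t" "t \<le> T" for s t
    using order_trans[OF Finite_Cartesian_Product.norm_nth_le M(2)[OF that], of i] by simp
  then show ?thesis using assms M(1) unfolding holder_path_iff by (blast intro: continuous_on_component)
qed

lemma holder_path_add:
  assumes "holder_path T \<gamma> f" "holder_path T \<gamma> g"
  shows "holder_path T \<gamma> (\<lambda>t. f t + g t)"
proof -
  obtain M where M: "0 \<le> M" "\<And>s t. 0 \<le> s \<Longrightarrow> s < t \<Longrightarrow> t \<le> T \<Longrightarrow> norm (f t - f s) \<le> M * (t - s) powr \<gamma>"
    using assms(1) unfolding holder_path_iff by blast
  obtain N where N: "0 \<le> N" "\<And>s t. 0 \<le> s \<Longrightarrow> s < t \<Longrightarrow> t \<le> T \<Longrightarrow> norm (g t - g s) \<le> N * (t - s) powr \<gamma>"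
    using assms(2) unfolding holder_path_iff by blast
  have "norm ((f t + g t) - (f s + g s)) \<le> (M + N) * (t - s) powr \<gamma>" if "0 \<le> s" "s < t" "t \<le> T" for s t
    using M(2)[OF that] N(2)[OF that] norm_triangle_ineq[of "f t - f s" "g t - g s"]
    by (simp add: algebra_simps)
  then show ?thesis using assms M(1) N(1) unfolding holder_path_iff
    by (intro conjI exI[of _ "M + N"] continuous_on_add) auto
qed

lemma holder_path_sum:
  assumes "finite A" "\<And>i. i \<in> A \<Longrightarrow> holder_path T \<gamma> (f i)"
  shows "holder_path T \<gamma> (\<lambda>t. \<Sum>i\<in>A. f i t)"
  using assms
proof (induction rule: finite_induct)
  case empty
  show ?case by (auto simp: holder_path_iff intro: exI[of _ 0])
qed (auto intro: holder_path_add)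

lemma holder_path_scaleR:
  assumes "holder_path T \<gamma> f" "holder_path T \<gamma> g"
  shows "holder_path T \<gamma> (\<lambda>t. f t *\<^sub>R g t)"
proof -
  obtain M where M: "0 \<le> M" "\<And>s t. 0 \<le> s \<Longrightarrow> s < t \<Longrightarrow> t \<le> T \<Longrightarrow> norm (f t - f s) \<le> M * (t - s) powr \<gamma>"
    using assms(1) unfolding holder_path_iff by blast
  obtain N where N: "0 \<le> N" "\<And>s t. 0 \<le> s \<Longrightarrow> s < t \<Longrightarrow> t \<le> T \<Longrightarrow> norm (g t - g s) \<le> N * (t - s) powr \<gamma>"
    using assms(2) unfolding holder_path_iff by blast
  obtain F where F: "0 \<le> F" "\<And>t. 0 \<le> t \<Longrightarrow> t \<le> T \<Longrightarrow> norm (f t) \<le> F"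
    using holder_path_bounded[OF assms(1)] by metis
  obtain G where G: "0 \<le> G" "\<And>t. 0 \<le> t \<Longrightarrow> t \<le> T \<Longrightarrow> norm (g t) \<le> G"
    using holder_path_bounded[OF assms(2)] by metis
  have "norm (f t *\<^sub>R g t - f s *\<^sub>R g s) \<le> (M * G + F * N) * (t - s) powr \<gamma>" if st: "0 \<le> s" "s < t" "t \<le> T" for s t
  proof -
    have "norm (f t *\<^sub>R g t - f s *\<^sub>R g s) = norm ((f t - f s) *\<^sub>R g t + f s *\<^sub>R (g t - g s))"
      by (simp add: algebra_simps)
    also have "\<dots> \<le> norm (f t - f s) * norm (g t) + norm (f s) * norm (g t - g s)"
      by (rule norm_triangle_le) simp
    also have "\<dots> \<le> M * (t - s) powr \<gamma> * G + F * (N * (t - s) powr \<gamma>)"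
      using st M N F G by (intro add_mono mult_mono) auto
    finally show ?thesis by (simp add: algebra_simps)
  qed
  then show ?thesis using assms M(1) N(1) F(1) G(1) unfolding holder_path_iff
    by (intro conjI exI[of _ "M * G + F * N"] continuous_on_scaleR) auto
qed

lemma holder_pathI:
  assumes \<gamma>: "0 < \<gamma>" and "0 \<le> M"
    and bound: "\<And>s t. 0 \<le> s \<Longrightarrow> s < t \<Longrightarrow> t \<le> T \<Longrightarrow> norm (f t - f s) \<le> M * (t - s) powr \<gamma>"
  shows "holder_path T \<gamma> f"
proof -
  have "continuous_on {0..T} f"
    unfolding continuous_on_iff
  proof (intro ballI allI impI)
    fix s e :: real assume s: "s \<in> {0..T}" and e: "0 < e"
    obtain d where d: "0 < d" "\<And>x. 0 < x \<Longrightarrow> x \<le> d \<Longrightarrow> M * x powr \<gamma> + 0 * x powr \<gamma> \<le> e / 2"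
      using ex_small_powr[of \<gamma> \<gamma> "e / 2" M 0] \<gamma> e \<open>0 \<le> M\<close> by auto
    have "dist (f t) (f s) < e" if t: "t \<in> {0..T}" "dist t s < d" for t
    proof (cases s t rule: linorder_cases)
      case less
      then have "dist (f t) (f s) \<le> e / 2"
        using bound[of s t] d(2)[of "t - s"] s t by (simp add: dist_norm)
      then show ?thesis using e by simp
    next
      case greater
      then have "dist (f t) (f s) \<le> e / 2"
        using bound[of t s] d(2)[of "s - t"] s t by (simp add: dist_norm norm_minus_commute)
      then show ?thesis using e by simp
    qed (use e in simp)
    then show "\<exists>d>0. \<forall>x'\<in>{0..T}. dist x' s < d \<longrightarrow> dist (f x') (f s) < e" using d(1) by blast
  qed
  then show ?thesis unfolding holder_path_iff using assms by blast
qed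

section \<open>The almost flow of the equation and its paths\<close>

context rde_data
begin

lemma affine_c: "affine_fun (\<lambda>x. c t x $ p)"
  unfolding c_nth
  by (intro affine_fun_add affine_fun_sum affine_fun_scaleR_left affine_fun_nth affine_fun_id affine_fun_const finite)

lemma affine_step: "affine_fun (step s t)"
proof -
  have c': "affine_fun (\<lambda>x. c' t x $ j $ p)" for t j p
    unfolding c'_nth
    by (intro affine_fun_add affine_fun_sum affine_fun_scaleR_left affine_fun_nth[OF affine_c]
        affine_fun_nth[OF affine_fun_id] affine_fun_const finite)
  have g: "affine_fun (\<lambda>x. g t x $ p $ q)" for t p q
    unfolding g_nth
    by (intro affine_fun_add affine_fun_sum affine_fun_scaleR_left affine_fun_nth affine_fun_id affine_fun_const finite)
  show ?thesis
    unfolding step_def rough_germ_def bracket_germ_def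
    by (intro affine_fun_add affine_fun_sum affine_fun_scaleR_right affine_fun_id affine_c c' g finite)
qed

lemma step_near_id:
  obtains C where "0 \<le> C"
    "\<And>s t x. 0 \<le> s \<Longrightarrow> s < t \<Longrightarrow> t \<le> T \<Longrightarrow> norm (step s t x - x) \<le> C * (t - s) powr \<alpha> * (1 + norm x)"
    "\<And>s t x. 0 \<le> s \<Longrightarrow> s < t \<Longrightarrow> t \<le> T \<Longrightarrow>
      norm (step s t x - x - (\<Sum>i\<in>UNIV. (\<omega> t - \<omega> s) $ i *\<^sub>R c s x $ i)) \<le> C * (t - s) powr (2 * \<alpha>) * (1 + norm x)"
proof -
  define S where "S = {(s, t, x :: real^'e). 0 \<le> s \<and> s < t \<and> t \<le> T}"
  \<comment> \<open>The midpoint only fills the slot of the middle time; the estimates concern the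
    outer times.\<close>
  interpret rde_sample T \<alpha> \<beta> \<omega> W a a' b b' \<Lambda> l S fst "\<lambda>z. (fst z + fst (snd z)) / 2" "\<lambda>z. fst (snd z)"
    "\<lambda>z. 1 + norm (snd (snd z))" "\<lambda>z. snd (snd z)"
    by unfold_locales (auto simp: S_def)
  have st: "\<And>z. z \<in> S \<Longrightarrow> fst z < fst (snd z) \<and> fst (snd z) \<le> fst (snd z)" by (auto simp: S_def)
  have B: "ord (2 * \<alpha>) 1 (\<lambda>z. \<Sum>p\<in>UNIV. \<Sum>q\<in>UNIV. bracket_germ p q (fst z) (fst (snd z)) (snd (snd z)))"
    by (intro ord_sum finite ord_germs(3)[OF st])
  have 1: "ord \<alpha> 1 (\<lambda>z. step (fst z) (fst (snd z)) (snd (snd z)) - snd (snd z))"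
    using ord_add[OF ord_germs(1)[OF st] ord_mono[OF B, of \<alpha> 1]] \<alpha>_pos by (simp add: step_def algebra_simps)
  have 2: "ord (2 * \<alpha>) 1 (\<lambda>z. step (fst z) (fst (snd z)) (snd (snd z)) - snd (snd z) -
     (\<Sum>i\<in>UNIV. (\<omega> (fst (snd z)) - \<omega> (fst z)) $ i *\<^sub>R c (fst z) (snd (snd z)) $ i))"
    using ord_add[OF ord_germs(2)[OF st] B] by (simp add: step_def algebra_simps)
  obtain C where C: "0 \<le> C" "\<And>s t x. (s, t, x) \<in> S \<Longrightarrow> norm (step s t x - x) \<le> C * ((t - s) powr \<alpha> * (1 + norm x))"
    using 1 unfolding ord_def by force
  obtain D where D: "0 \<le> D" "\<And>s t x. (s, t, x) \<in> S \<Longrightarrow>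
      norm (step s t x - x - (\<Sum>i\<in>UNIV. (\<omega> t - \<omega> s) $ i *\<^sub>R c s x $ i)) \<le> D * ((t - s) powr (2 * \<alpha>) * (1 + norm x))"
    using 2 unfolding ord_def by force
  show thesis
  proof (rule that[of "max C D"])
    fix s t and x :: "real^'e" assume "0 \<le> s" "s < t" "t \<le> T"
    then have z: "(s, t, x) \<in> S" by (simp add: S_def)
    show "norm (step s t x - x) \<le> max C D * (t - s) powr \<alpha> * (1 + norm x)"
      unfolding mult.assoc by (rule order_trans[OF C(2)[OF z]]) (intro mult_right_mono, auto)
    show "norm (step s t x - x - (\<Sum>i\<in>UNIV. (\<omega> t - \<omega> s) $ i *\<^sub>R c s x $ i)) \<le> max C D * (t - s) powr (2 * \<alpha>) * (1 + norm x)"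
      unfolding mult.assoc by (rule order_trans[OF D(2)[OF z]]) (intro mult_right_mono, auto)
  qed (use C in simp)
qed

lemma step_defect:
  obtains C where "0 \<le> C" "\<And>s r t x. 0 \<le> s \<Longrightarrow> s < r \<Longrightarrow> r < t \<Longrightarrow> t \<le> T \<Longrightarrow>
    norm (step r t (step s r x) - step s t x) \<le> C * (t - s) powr (2 * \<alpha> + \<beta>) * (1 + norm x)"
proof -
  define S where "S = {(s, r, t, x :: real^'e). 0 \<le> s \<and> s < r \<and> r < t \<and> t \<le> T}"
  define s where "s = (\<lambda>z :: real \<times> real \<times> real \<times> (real^'e). fst z)"
  define r where "r = (\<lambda>z :: real \<times> real \<times> real \<times> (real^'e). fst (snd z))"
  define t where "t = (\<lambda>z :: real \<times> real \<times> real \<times> (real^'e). fst (snd (snd z)))"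
  define x where "x = (\<lambda>z :: real \<times> real \<times> real \<times> (real^'e). snd (snd (snd z)))"
  interpret rde_sample T \<alpha> \<beta> \<omega> W a a' b b' \<Lambda> l S s r t "\<lambda>z. 1 + norm (x z)" x
    by unfold_locales (auto simp: S_def s_def r_def t_def)
  have sr: "\<And>z. z \<in> S \<Longrightarrow> s z < r z \<and> r z \<le> t z" by (auto simp: S_def s_def r_def t_def)
  have B: "ord (2 * \<alpha>) 1 (\<lambda>z. \<Sum>p\<in>UNIV. \<Sum>q\<in>UNIV. bracket_germ p q (s z) (r z) (x z))"
    by (intro ord_sum finite ord_germs(3)[OF sr])
  have "ord (2 * \<alpha>) 1 (\<lambda>z. step (s z) (r z) (x z) - x z - (\<Sum>i\<in>UNIV. (\<omega> (r z) - \<omega> (s z)) $ i *\<^sub>R c (s z) (x z) $ i))"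
    using ord_add[OF ord_germs(2)[OF sr] B] by (simp add: step_def algebra_simps)
  \<comment> \<open>The one-step remainder has order 2\<alpha>, which is enough because \<beta>
    \<le> \<alpha>.\<close>
  then have "ord (\<alpha> + \<beta>) 1 (\<lambda>z. step (s z) (r z) (x z) - x z - (\<Sum>i\<in>UNIV. (\<omega> (r z) - \<omega> (s z)) $ i *\<^sub>R c (s z) (x z) $ i))"
    by (rule ord_mono) (use \<beta>_le in simp_all)
  then interpret rde_sample_step T \<alpha> \<beta> \<omega> W a a' b b' \<Lambda> l S s r t "\<lambda>z. 1 + norm (x z)" x "\<lambda>z. step (s z) (r z) (x z)"
    by unfold_locales
  have "ord (2 * \<alpha> + \<beta>) 1 (\<lambda>z. (rough_germ (s z) (r z) (x z) + rough_germ (r z) (t z) (step (s z) (r z) (x z)) - rough_germ (s z) (t z) (x z))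
      + (\<Sum>p\<in>UNIV. \<Sum>q\<in>UNIV. bracket_germ p q (s z) (r z) (x z) + bracket_germ p q (r z) (t z) (step (s z) (r z) (x z)) - bracket_germ p q (s z) (t z) (x z)))"
    by (intro ord_add ord_rough_defect ord_sum ord_bracket_defect finite)
  moreover have "(rough_germ (s z) (r z) (x z) + rough_germ (r z) (t z) (step (s z) (r z) (x z)) - rough_germ (s z) (t z) (x z))
      + (\<Sum>p\<in>UNIV. \<Sum>q\<in>UNIV. bracket_germ p q (s z) (r z) (x z) + bracket_germ p q (r z) (t z) (step (s z) (r z) (x z)) - bracket_germ p q (s z) (t z) (x z))
      = step (r z) (t z) (step (s z) (r z) (x z)) - step (s z) (t z) (x z)" for z
    by (simp add: step_def[of "r z"] step_def[of "s z" "t z"] sum.distrib sum_subtractf)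
      (simp add: step_def[of "s z" "r z" "x z"])
  ultimately have "ord (2 * \<alpha> + \<beta>) 1 (\<lambda>z. step (r z) (t z) (step (s z) (r z) (x z)) - step (s z) (t z) (x z))"
    by simp
  then obtain C where C: "0 \<le> C" "\<And>z. z \<in> S \<Longrightarrow> norm (step (r z) (t z) (step (s z) (r z) (x z)) - step (s z) (t z) (x z))
      \<le> C * ((t z - s z) powr (2 * \<alpha> + \<beta>) * (1 + norm (x z)) ^ 1)"
    unfolding ord_def by blast
  show thesis
  proof (rule that[OF C(1)])
    fix s' r' t' and x' :: "real^'e" assume "0 \<le> s'" "s' < r'" "r' < t'" "t' \<le> T"
    then show "norm (step r' t' (step s' r' x') - step s' t' x') \<le> C * (t' - s') powr (2 * \<alpha> + \<beta>) * (1 + norm x')"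
      using C(2)[of "(s', r', t', x')"] by (simp add: S_def s_def r_def t_def x_def mult.assoc)
  qed
qed

lemma almost_flow_step:
  obtains C where "almost_flow T C \<alpha> (2 * \<alpha> + \<beta>) step"
proof -
  obtain C where C: "0 \<le> C"
    "\<And>s t x. 0 \<le> s \<Longrightarrow> s < t \<Longrightarrow> t \<le> T \<Longrightarrow> norm (step s t x - x) \<le> C * (t - s) powr \<alpha> * (1 + norm x)"
    using step_near_id by metis
  obtain D where D: "0 \<le> D" "\<And>s r t x. 0 \<le> s \<Longrightarrow> s < r \<Longrightarrow> r < t \<Longrightarrow> t \<le> T \<Longrightarrow>
    norm (step r t (step s r x) - step s t x) \<le> D * (t - s) powr (2 * \<alpha> + \<beta>) * (1 + norm x)"
    using step_defect by metis
  show thesis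
  proof (rule that[of "max C D"], rule almost_flow.intro)
    fix s t assume st: "0 \<le> s" "s < t" "t \<le> T"
    show "linear (\<lambda>x. step s t x - step s t 0)" using affine_step by (simp add: affine_fun_def)
    fix x
    show "norm (step s t x - x) \<le> max C D * (t - s) powr \<alpha> * (1 + norm x)"
      by (rule order_trans[OF C(2)[OF st]]) (intro mult_right_mono, auto)
  next
    fix s r t x assume srt: "0 \<le> s" "s < r" "r < t" "t \<le> T"
    show "norm (step r t (step s r x) - step s t x) \<le> max C D * (t - s) powr (2 * \<alpha> + \<beta>) * (1 + norm x)"
      by (rule order_trans[OF D(2)[OF srt]]) (intro mult_right_mono, auto)
  qed (use C T_pos \<alpha>_pos \<mu>_gt_1 in auto)
qed

text \<open>The remainder bound of a controlled path is precisely what the defect estimates require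
  of the state at time r, so they apply with \<theta> in place of the one-step image. As \<theta> is
  bounded, the weight is a constant.\<close>

lemma controlled_germ_sewing:
  assumes ctrl: "controlled1 T \<alpha> \<beta> \<omega> \<theta> \<theta>'" and \<theta>': "\<And>t. 0 \<le> t \<Longrightarrow> t \<le> T \<Longrightarrow> \<theta>' t = c t (\<theta> t)"
  obtains I Y where "I 0 = 0" "small_order T (2 * \<alpha> + \<beta>) (\<lambda>s t. I t - I s - rough_germ s t (\<theta> s))"
    "\<And>p q. Y p q 0 = 0"
    "\<And>p q. small_order T (2 * \<alpha> + \<beta>) (\<lambda>s t. Y p q t - Y p q s - bracket_germ p q s t (\<theta> s))"
proof -
  obtain M where M: "0 \<le> M" "\<And>t. 0 \<le> t \<Longrightarrow> t \<le> T \<Longrightarrow> norm (\<theta> t) \<le> M"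
    using holder_path_bounded[of T \<beta> \<theta>] ctrl unfolding controlled1_def by metis
  define S where "S = {(s :: real, r, t). 0 \<le> s \<and> s < r \<and> r < t \<and> t \<le> T}"
  define s where "s = (\<lambda>z :: real \<times> real \<times> real. fst z)"
  define r where "r = (\<lambda>z :: real \<times> real \<times> real. fst (snd z))"
  define t where "t = (\<lambda>z :: real \<times> real \<times> real. snd (snd z))"
  have zS: "0 \<le> s z \<and> s z < r z \<and> r z < t z \<and> t z \<le> T" if "z \<in> S" for z
    using that by (auto simp: S_def s_def r_def t_def)
  interpret rde_sample T \<alpha> \<beta> \<omega> W a a' b b' \<Lambda> l S s r t "\<lambda>_. 1 + M" "\<lambda>z. \<theta> (s z)"
  proof
    fix z assume z: "z \<in> S"
    show "0 \<le> s z \<and> s z < r z \<and> r z < t z \<and> t z \<le> T" by (rule zS[OF z])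
    show "1 \<le> 1 + M" using M by simp
    show "norm (\<theta> (s z)) \<le> 1 + M" using M(2)[of "s z"] zS[OF z] by simp
  qed
  have sr: "0 \<le> s z \<and> s z < r z \<and> r z \<le> T \<and> r z - s z \<le> t z - s z" if "z \<in> S" for z
    using zS[OF that] by auto
  have \<theta>'_s: "\<theta>' (s z) = c (s z) (\<theta> (s z))" if "z \<in> S" for z
    using \<theta>' zS[OF that] by simp
  have "ord (\<alpha> + \<beta>) 0 (\<lambda>z. \<theta> (r z) - \<theta> (s z) - (\<Sum>i\<in>UNIV. (\<omega> (r z) - \<omega> (s z)) $ i *\<^sub>R \<theta>' (s z) $ i))"
    using ctrl \<alpha>_pos \<beta>_pos
    by (intro ord_holder_pairs[of "\<alpha> + \<beta>" "\<lambda>s t. \<theta> t - \<theta> s - (\<Sum>i\<in>UNIV. (\<omega> t - \<omega> s) $ i *\<^sub>R \<theta>' s $ i)", OF _ _ sr])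
      (simp_all add: controlled1_def)
  then have "ord (\<alpha> + \<beta>) 1 (\<lambda>z. \<theta> (r z) - \<theta> (s z) - (\<Sum>i\<in>UNIV. (\<omega> (r z) - \<omega> (s z)) $ i *\<^sub>R \<theta>' (s z) $ i))"
    by (rule ord_mono) simp_all
  then have "ord (\<alpha> + \<beta>) 1 (\<lambda>z. \<theta> (r z) - \<theta> (s z) - (\<Sum>i\<in>UNIV. (\<omega> (r z) - \<omega> (s z)) $ i *\<^sub>R c (s z) (\<theta> (s z)) $ i))"
    by (rule ord_cong[THEN iffD1, rotated]) (use \<theta>'_s in simp)
  then interpret rde_sample_step T \<alpha> \<beta> \<omega> W a a' b b' \<Lambda> l S s r t "\<lambda>_. 1 + M" "\<lambda>z. \<theta> (s z)" "\<lambda>z. \<theta> (r z)"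
    by unfold_locales
  have sew: "\<exists>u. u 0 = 0 \<and> small_order T (2 * \<alpha> + \<beta>) (\<lambda>s t. u t - u s - \<Xi> s t)"
    if 1: "ord \<alpha> 1 (\<lambda>z. \<Xi> (s z) (t z))" and 2: "ord (2 * \<alpha> + \<beta>) 1 (\<lambda>z. \<Xi> (s z) (r z) + \<Xi> (r z) (t z) - \<Xi> (s z) (t z))"
    for \<Xi> :: "real \<Rightarrow> real \<Rightarrow> real^'e"
  proof -
    obtain C where C: "0 \<le> C" "\<And>z. z \<in> S \<Longrightarrow> norm (\<Xi> (s z) (t z)) \<le> C * ((t z - s z) powr \<alpha> * (1 + M) ^ 1)"
      using 1 unfolding ord_def by blast
    obtain D where D: "0 \<le> D" "\<And>z. z \<in> S \<Longrightarrow> norm (\<Xi> (s z) (r z) + \<Xi> (r z) (t z) - \<Xi> (s z) (t z))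
        \<le> D * ((t z - s z) powr (2 * \<alpha> + \<beta>) * (1 + M) ^ 1)"
      using 2 unfolding ord_def by blast
    define E where "E = max C D * (1 + M)"
    have E: "C * (x * (1 + M) ^ 1) \<le> E * x" "D * (x * (1 + M) ^ 1) \<le> E * x" if "0 \<le> x" for x
      using that M mult_right_mono[of C "max C D" "x * (1 + M)"] mult_right_mono[of D "max C D" "x * (1 + M)"]
      by (simp_all add: E_def mult_ac)
    obtain u where "u 0 = 0" "small_order T (2 * \<alpha> + \<beta>) (\<lambda>s t. u t - u s - \<Xi> s t)"
    proof (rule additive_sewing[of T E \<alpha> "2 * \<alpha> + \<beta>" \<Xi>])
      show "0 \<le> E" using C M by (simp add: E_def le_max_iff_disj)
      fix s' t' :: real assume st: "0 \<le> s'" "s' < t'" "t' \<le> T"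
      \<comment> \<open>The midpoint again only completes the pair to a sample.\<close>
      have "(s', (s' + t') / 2, t') \<in> S" using st by (auto simp: S_def)
      from C(2)[OF this] show "norm (\<Xi> s' t') \<le> E * (t' - s') powr \<alpha>"
        using E(1)[of "(t' - s') powr \<alpha>"] by (simp add: s_def t_def)
    next
      fix s' r' t' :: real assume "0 \<le> s'" "s' < r'" "r' < t'" "t' \<le> T"
      then have "(s', r', t') \<in> S" by (auto simp: S_def)
      from D(2)[OF this] show "norm (\<Xi> s' r' + \<Xi> r' t' - \<Xi> s' t') \<le> E * (t' - s') powr (2 * \<alpha> + \<beta>)"
        using E(2)[of "(t' - s') powr (2 * \<alpha> + \<beta>)"] by (simp add: s_def r_def t_def)
    qed (use T_pos \<alpha>_pos \<mu>_gt_1 in auto)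
    then show ?thesis by blast
  qed
  have st: "\<And>z. z \<in> S \<Longrightarrow> s z < t z \<and> t z \<le> t z" using zS by fastforce
  obtain I where I: "I 0 = 0" "small_order T (2 * \<alpha> + \<beta>) (\<lambda>s t. I t - I s - rough_germ s t (\<theta> s))"
    using sew[OF ord_germs(1)[OF st] ord_rough_defect] by blast
  have "\<forall>p q. \<exists>u. u 0 = 0 \<and> small_order T (2 * \<alpha> + \<beta>) (\<lambda>s t. u t - u s - bracket_germ p q s t (\<theta> s))"
    using \<alpha>_pos by (intro allI sew[OF ord_mono[OF ord_germs(3)[OF st]] ord_bracket_defect]) simp_all
  then have ex: "\<exists>u. u 0 = 0 \<and> small_order T (2 * \<alpha> + \<beta>) (\<lambda>s t. u t - u s - bracket_germ p q s t (\<theta> s))" for p q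
    by blast
  define Y where "Y p q = (SOME u. u 0 = 0 \<and>
      small_order T (2 * \<alpha> + \<beta>) (\<lambda>s t. u t - u s - bracket_germ p q s t (\<theta> s)))" for p q
  have Y: "Y p q 0 = 0 \<and> small_order T (2 * \<alpha> + \<beta>) (\<lambda>s t. Y p q t - Y p q s - bracket_germ p q s t (\<theta> s))" for p q
    unfolding Y_def by (rule someI_ex[OF ex])
  show thesis by (rule that[of I Y]) (use I Y in simp_all)
qed

text \<open>Davie's characterization of solutions: by sewing, both integrals along a controlled path are
  determined by their germs, which add up to the increment of the one-step scheme.\<close>

lemma solution_iff:
  assumes ctrl: "controlled1 T \<alpha> \<beta> \<omega> \<theta> \<theta>'" and \<theta>': "\<And>t. 0 \<le> t \<Longrightarrow> t \<le> T \<Longrightarrow> \<theta>' t = c t (\<theta> t)"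
  shows "linear_rde_solution T \<alpha> \<beta> \<omega> W a a' b b' \<Lambda> l y0 \<theta> \<theta>' \<longleftrightarrow>
    \<theta> 0 = y0 \<and> small_order T (2 * \<alpha> + \<beta>) (\<lambda>s t. \<theta> t - step s t (\<theta> s))"
proof -
  obtain I Y where I: "I 0 = 0" "small_order T (2 * \<alpha> + \<beta>) (\<lambda>s t. I t - I s - rough_germ s t (\<theta> s))"
    and Y: "\<And>p q. Y p q 0 = 0"
      "\<And>p q. small_order T (2 * \<alpha> + \<beta>) (\<lambda>s t. Y p q t - Y p q s - bracket_germ p q s t (\<theta> s))"
    by (rule controlled_germ_sewing[OF ctrl \<theta>']) (assumption+, rule that)
  define u where "u t = I t + (\<Sum>p\<in>UNIV. \<Sum>q\<in>UNIV. Y p q t)" for t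
  have u0: "u 0 = 0" by (simp add: u_def I Y)
  have "small_order T (2 * \<alpha> + \<beta>) (\<lambda>s t. (I t - I s - rough_germ s t (\<theta> s)) +
      (\<Sum>p\<in>UNIV. \<Sum>q\<in>UNIV. Y p q t - Y p q s - bracket_germ p q s t (\<theta> s)))"
    by (intro small_order_add small_order_sum I Y finite)
  then have u: "small_order T (2 * \<alpha> + \<beta>) (\<lambda>s t. u t - u s - (step s t (\<theta> s) - \<theta> s))"
    by (simp add: u_def step_def sum.distrib sum_subtractf algebra_simps)
  \<comment> \<open>The limit exists and is unique, so the integral predicate becomes an equation;
    together with its bracket counterpart this removes the existential quantifiers from the notion
    of solution.\<close>
  have rough: "has_rough_integral \<omega> W (\<lambda>s. tensor1 (a s) (\<theta> s) + b s)
          (\<lambda>s. integrand_deriv (a s) (a' s) (b' s) (\<theta> s) (\<theta>' s)) t J \<longleftrightarrow> J = I t" if t: "0 \<le> t" "t \<le> T" for t J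
  proof -
    have "has_rough_integral \<omega> W (\<lambda>s. tensor1 (a s) (\<theta> s) + b s)
          (\<lambda>s. integrand_deriv (a s) (a' s) (b' s) (\<theta> s) (\<theta>' s)) t J
        \<longleftrightarrow> has_partition_limit (\<lambda>u v. rough_germ u v (\<theta> u)) t J"
      unfolding has_rough_integral_def
      by (rule has_partition_limit_cong) (use t \<theta>' in \<open>simp add: rough_germ_def c'_def c_def\<close>)
    moreover have "has_partition_limit (\<lambda>u v. rough_germ u v (\<theta> u)) t (I t)"
      using has_partition_limit_small_order[OF \<mu>_gt_1 I(2) t] I(1) by simp
    ultimately show ?thesis using has_partition_limit_unique[OF t(1)] by blast
  qed
  have young: "has_young_integral (\<lambda>s. (tensor2 (\<Lambda> s) (\<theta> s) + l s) $ p $ q) (\<lambda>s. bracket \<omega> W s $ p $ q) t J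
      \<longleftrightarrow> J = Y p q t" if t: "0 \<le> t" "t \<le> T" for t J p q
  proof -
    have "has_young_integral (\<lambda>s. (tensor2 (\<Lambda> s) (\<theta> s) + l s) $ p $ q) (\<lambda>s. bracket \<omega> W s $ p $ q) t J
        \<longleftrightarrow> has_partition_limit (\<lambda>u v. bracket_germ p q u v (\<theta> u)) t J"
      by (simp add: has_young_integral_def bracket_germ_def g_def)
    moreover have "has_partition_limit (\<lambda>u v. bracket_germ p q u v (\<theta> u)) t (Y p q t)"
      using has_partition_limit_small_order[OF \<mu>_gt_1 Y(2) t, of p q] Y(1) by simp
    ultimately show ?thesis using has_partition_limit_unique[OF t(1)] by blast
  qed
  have bracket: "has_bracket_integral \<omega> W (\<lambda>s. tensor2 (\<Lambda> s) (\<theta> s) + l s) t J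
      \<longleftrightarrow> J = (\<Sum>p\<in>UNIV. \<Sum>q\<in>UNIV. Y p q t)" if t: "0 \<le> t" "t \<le> T" for t J
  proof -
    have "has_bracket_integral \<omega> W (\<lambda>s. tensor2 (\<Lambda> s) (\<theta> s) + l s) t J \<longleftrightarrow>
      (\<exists>Z. (\<forall>p q. Z p q = Y p q t) \<and> J = (\<Sum>p\<in>UNIV. \<Sum>q\<in>UNIV. Z p q))"
      unfolding has_bracket_integral_def young[OF t] ..
    also have "\<dots> \<longleftrightarrow> J = (\<Sum>p\<in>UNIV. \<Sum>q\<in>UNIV. Y p q t)" by auto
    finally show ?thesis .
  qed
  have "linear_rde_solution T \<alpha> \<beta> \<omega> W a a' b b' \<Lambda> l y0 \<theta> \<theta>' \<longleftrightarrow> (\<forall>t\<in>{0..T}. \<theta> t = y0 + u t)"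
    unfolding linear_rde_solution_def using ctrl \<theta>' rough bracket
    by (auto simp: u_def c_def add.assoc)
  also have "\<dots> \<longleftrightarrow> \<theta> 0 = y0 \<and> small_order T (2 * \<alpha> + \<beta>) (\<lambda>s t. \<theta> t - step s t (\<theta> s))"
  proof (intro iffI conjI)
    assume eq: "\<forall>t\<in>{0..T}. \<theta> t = y0 + u t"
    then show "\<theta> 0 = y0" using T_pos u0 by simp
    show "small_order T (2 * \<alpha> + \<beta>) (\<lambda>s t. \<theta> t - step s t (\<theta> s))"
      by (rule small_order_cong[THEN iffD1, OF _ u]) (use eq in \<open>simp add: algebra_simps\<close>)
  next
    assume "\<theta> 0 = y0 \<and> small_order T (2 * \<alpha> + \<beta>) (\<lambda>s t. \<theta> t - step s t (\<theta> s))"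
    then have \<theta>0: "\<theta> 0 = y0" and "small_order T (2 * \<alpha> + \<beta>) (\<lambda>s t. \<theta> t - step s t (\<theta> s))" by auto
    from small_order_diff[OF this(2) u]
    \<comment> \<open>\<theta> and u have the same germ, hence their difference has increments of
      order above 1 and is constant.\<close>
    have so: "small_order T (2 * \<alpha> + \<beta>) (\<lambda>s t. (\<theta> t - u t) - (\<theta> s - u s))"
      by (simp add: algebra_simps)
    show "\<forall>t\<in>{0..T}. \<theta> t = y0 + u t"
    proof
      fix t assume t: "t \<in> {0..T}"
      have "\<theta> t - u t = \<theta> 0 - u 0"
        by (rule small_order_increments_const[OF \<mu>_gt_1 so]) (use t in auto)
      then show "\<theta> t = y0 + u t" using \<theta>0 u0 by (simp add: algebra_simps)
    qed
  qed
  finally show ?thesis .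
qed

text \<open>Up to an error of order \<open>2 * \<alpha> + \<beta>\<close> a flow path moves like one
  step of the scheme, whose expansion in \<omega> is explicit; the coefficient of the first-level
  term must then be the derivative.\<close>

lemma flow_controlled:
  assumes bound: "\<And>t. norm (\<theta> t) \<le> M" and so: "small_order T (2 * \<alpha> + \<beta>) (\<lambda>s t. \<theta> t - step s t (\<theta> s))"
  shows "controlled1 T \<alpha> \<beta> \<omega> \<theta> (\<lambda>t. c t (\<theta> t))"
proof -
  have M: "0 \<le> M" using order_trans[OF norm_ge_zero bound] .
  obtain C0 where "almost_flow T C0 \<alpha> (2 * \<alpha> + \<beta>) step" using almost_flow_step .
  then interpret flow: almost_flow T C0 \<alpha> "2 * \<alpha> + \<beta>" step .
  obtain K where K: "0 \<le> K"
    "\<And>s t. 0 \<le> s \<Longrightarrow> s < t \<Longrightarrow> t \<le> T \<Longrightarrow> norm (\<theta> t - step s t (\<theta> s)) \<le> K * (t - s) powr (2 * \<alpha> + \<beta>)"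
    by (rule flow.global_error[OF bound so]) (rule that)
  obtain C where C: "0 \<le> C"
    "\<And>s t x. 0 \<le> s \<Longrightarrow> s < t \<Longrightarrow> t \<le> T \<Longrightarrow> norm (step s t x - x) \<le> C * (t - s) powr \<alpha> * (1 + norm x)"
    "\<And>s t x. 0 \<le> s \<Longrightarrow> s < t \<Longrightarrow> t \<le> T \<Longrightarrow>
      norm (step s t x - x - (\<Sum>i\<in>UNIV. (\<omega> t - \<omega> s) $ i *\<^sub>R c s x $ i)) \<le> C * (t - s) powr (2 * \<alpha>) * (1 + norm x)"
    by (rule step_near_id) (rule that)
  \<comment> \<open>Used twice: with \<gamma> = \<beta>, \<delta> = \<alpha> and v =
    \<open>\<theta> s\<close> for the Hoelder bound on \<theta>, and with \<gamma> = \<alpha> +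
    \<beta>, \<delta> = 2\<alpha> and v the first-order expansion for the remainder.\<close>
  have estimate: "norm (\<theta> t - v) \<le> (K * T powr (2 * \<alpha> + \<beta> - \<gamma>) + C * T powr (\<delta> - \<gamma>) * (1 + M)) * (t - s) powr \<gamma>"
    if st: "0 \<le> s" "s < t" "t \<le> T" and v: "norm (step s t (\<theta> s) - v) \<le> C * (t - s) powr \<delta> * (1 + norm (\<theta> s))"
      and \<gamma>: "\<gamma> \<le> 2 * \<alpha> + \<beta>" "\<gamma> \<le> \<delta>" for s t v \<gamma> \<delta>
  proof -
    have "norm (\<theta> t - step s t (\<theta> s)) \<le> K * (T powr (2 * \<alpha> + \<beta> - \<gamma>) * (t - s) powr \<gamma>)"
      by (rule order_trans[OF K(2)[OF st] mult_left_mono[OF powr_le_lower_powr K(1)]]) (use st \<gamma> in auto)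
    moreover have "norm (step s t (\<theta> s) - v) \<le> C * (T powr (\<delta> - \<gamma>) * (t - s) powr \<gamma>) * (1 + M)"
      by (rule order_trans[OF v], intro mult_mono mult_left_mono add_left_mono powr_le_lower_powr)
        (use st \<gamma> C bound in auto)
    ultimately show ?thesis
      using norm_triangle_ineq[of "\<theta> t - step s t (\<theta> s)" "step s t (\<theta> s) - v"]
      by (simp add: algebra_simps)
  qed
  have \<theta>: "holder_path T \<beta> \<theta>"
    by (rule holder_pathI[OF \<beta>_pos _ estimate[OF _ _ _ C(2)]]) (use K C M \<alpha>_pos \<beta>_pos \<beta>_le in auto)
  have "holder_path T \<beta> (\<lambda>t. c t (\<theta> t) $ p)" for p
    unfolding c_nth using a_ctrl b_ctrl \<theta>
    by (intro holder_path_add holder_path_sum holder_path_scaleR holder_path_nth finite) (auto simp: controlled1_def)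
  then have \<theta>': "holder_path T \<beta> (\<lambda>t. c t (\<theta> t))" by (rule holder_path_vec)
  have \<omega>: "continuous_on {0..T} \<omega>" using rp by (simp add: rough_path0_def holder_path_def)
  have cont: "continuous_on (time_pairs T) (\<lambda>z. f (fst z))" "continuous_on (time_pairs T) (\<lambda>z. f (snd z))"
    if "continuous_on {0..T} f" for f :: "real \<Rightarrow> 'z::topological_space"
    by (rule continuous_on_compose2[OF that]; auto simp: time_pairs_def intro!: continuous_intros)+
  have "continuous_on (time_pairs T) (\<lambda>z. \<theta> (snd z) - \<theta> (fst z)
      - (\<Sum>i\<in>UNIV. (\<omega> (snd z) - \<omega> (fst z)) $ i *\<^sub>R c (fst z) (\<theta> (fst z)) $ i))"
    using \<theta> \<theta>' by (intro continuous_on_diff continuous_on_sum continuous_on_scaleR continuous_on_component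
      cont[OF \<omega>] cont(1)[of "\<lambda>t. c t (\<theta> t)"] cont[of \<theta>]) (auto simp: holder_path_def)
  then have "holder_pairs T (\<alpha> + \<beta>) (\<lambda>s t. \<theta> t - \<theta> s - (\<Sum>i\<in>UNIV. (\<omega> t - \<omega> s) $ i *\<^sub>R c s (\<theta> s) $ i))"
    unfolding holder_pairs_iff split_beta
  proof (intro conjI exI allI impI)
    fix s t :: real assume st: "0 \<le> s" "s < t" "t \<le> T"
    show "norm (\<theta> t - \<theta> s - (\<Sum>i\<in>UNIV. (\<omega> t - \<omega> s) $ i *\<^sub>R c s (\<theta> s) $ i))
      \<le> (K * T powr (2 * \<alpha> + \<beta> - (\<alpha> + \<beta>)) + C * T powr (2 * \<alpha> - (\<alpha> + \<beta>)) * (1 + M)) * (t - s) powr (\<alpha> + \<beta>)"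
      unfolding diff_diff_eq
      by (rule estimate[OF st]) (use C(3)[OF st, of "\<theta> s"] \<alpha>_pos \<beta>_le in \<open>auto simp: diff_diff_eq\<close>)
  qed (use K C M in auto)
  then show ?thesis using \<theta> \<theta>' by (simp add: controlled1_def)
qed

text \<open>Uniqueness of the derivative comes with that of the path, because the notion of solution
  prescribes it as a function of the current state.\<close>

theorem solution_exists_unique:
  "\<exists>\<theta> \<theta>'. linear_rde_solution T \<alpha> \<beta> \<omega> W a a' b b' \<Lambda> l y0 \<theta> \<theta>' \<and>
     (\<forall>\<eta> \<eta>'. linear_rde_solution T \<alpha> \<beta> \<omega> W a a' b b' \<Lambda> l y0 \<eta> \<eta>' \<longrightarrow>
        (\<forall>t\<in>{0..T}. \<eta> t = \<theta> t \<and> \<eta>' t = \<theta>' t))"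
proof -
  obtain C where "almost_flow T C \<alpha> (2 * \<alpha> + \<beta>) step" using almost_flow_step .
  then interpret almost_flow T C \<alpha> "2 * \<alpha> + \<beta>" step .
  obtain \<theta> M where \<theta>: "\<theta> 0 = y0" "\<And>t. norm (\<theta> t) \<le> M" "small_order T (2 * \<alpha> + \<beta>) (\<lambda>s t. \<theta> t - step s t (\<theta> s))"
    by (rule flow_exists[of y0]) (rule that)
  have sol: "linear_rde_solution T \<alpha> \<beta> \<omega> W a a' b b' \<Lambda> l y0 \<theta> (\<lambda>t. c t (\<theta> t))"
    using solution_iff[OF flow_controlled[OF \<theta>(2,3)]] \<theta>(1,3) by simp
  moreover have "\<eta> t = \<theta> t \<and> \<eta>' t = c t (\<theta> t)"
    if \<eta>: "linear_rde_solution T \<alpha> \<beta> \<omega> W a a' b b' \<Lambda> l y0 \<eta> \<eta>'" and t: "t \<in> {0..T}" for \<eta> \<eta>' t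
  proof -
    have ctrl: "controlled1 T \<alpha> \<beta> \<omega> \<eta> \<eta>'" and \<eta>': "\<And>t. 0 \<le> t \<Longrightarrow> t \<le> T \<Longrightarrow> \<eta>' t = c t (\<eta> t)"
      using \<eta> by (auto simp: linear_rde_solution_def c_def)
    have "\<eta> 0 = y0" "small_order T (2 * \<alpha> + \<beta>) (\<lambda>s t. \<eta> t - step s t (\<eta> s))"
      using solution_iff[OF ctrl \<eta>'] \<eta> by auto
    then have "\<eta> t = \<theta> t" using flow_unique[of \<eta> \<theta> t] \<theta> t by simp
    then show ?thesis using \<eta>' t by simp
  qed
  ultimately show ?thesis by blast
qed

end

theorem theorem4p5:
  fixes T \<alpha> \<beta> :: real
    and \<omega> :: "real \<Rightarrow> real^'d" and W :: "real \<Rightarrow> real \<Rightarrow> real^'d^'d"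
    and y0 :: "real^'e"
    and a :: "real \<Rightarrow> (real^'e)^'e^'d" and a' :: "real \<Rightarrow> ((real^'e)^'e^'d)^'d"
    and b :: "real \<Rightarrow> (real^'e)^'d" and b' :: "real \<Rightarrow> ((real^'e)^'d)^'d"
    and \<Lambda> :: "real \<Rightarrow> (real^'e)^'e^'d^'d" and l :: "real \<Rightarrow> (real^'e)^'d^'d"
  assumes "T > 0"
    and "1/3 < \<alpha>" and "\<alpha> < 1/2" and "1 - 2 * \<alpha> < \<beta>" and "\<beta> \<le> \<alpha>"
    and "rough_path T \<alpha> \<omega> W"
    and "controlled2 T \<alpha> \<beta> \<omega> W a a'"
    and "controlled1 T \<alpha> \<beta> \<omega> b b'"
    and "holder_path T \<beta> \<Lambda>"
    and "holder_path T \<beta> l"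
  shows "\<exists>\<theta> \<theta>'. linear_rde_solution T \<alpha> \<beta> \<omega> W a a' b b' \<Lambda> l y0 \<theta> \<theta>' \<and>
           (\<forall>\<eta> \<eta>'. linear_rde_solution T \<alpha> \<beta> \<omega> W a a' b b' \<Lambda> l y0 \<eta> \<eta>' \<longrightarrow>
              (\<forall>t\<in>{0..T}. \<eta> t = \<theta> t \<and> \<eta>' t = \<theta>' t))"
proof -
  \<comment> \<open>\<open>1 - 2 * \<alpha> < \<beta>\<close> is the condition that the defect order
    exceeds 1, and with \<alpha> < 1/2 it also makes \<beta> positive.\<close>
  interpret rde_data T \<alpha> \<beta> \<omega> W a a' b b' \<Lambda> l
    by unfold_locales (use assms in \<open>simp_all add: rough_path_def controlled2_def\<close>)
  show ?thesis by (rule solution_exists_unique)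
qed

end
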